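(* Let $h_0=-d^2/dx^2+V_0(x)$ on $(a,b)$ with zero boundary conditions, and let $h_1$ be related to $h_0$ by a SUSY transformation with factorization constant $\alpha$ and transformation operator $L$. Let $E\notin\mathrm{spec}\,h_0$, $E\ne\alpha$. Let $f_{l0}(x,E)$ and $f_{r0}(x,E)$ be solutions of $(h_0-E)f=0$ satisfying the zero boundary condition at the left endpoint $a$ and at the right endpoint $b$ respectively, and let $$f_{l1}(x,E)=Lf_{l0}(x,E),\qquad f_{r1}(x,E)=Lf_{r0}(x,E)$$ be the similar solutions for $h_1$. Let $W_0=W(f_{r0},f_{l0})=f_{r0}f_{l0}'-f_{r0}'f_{l0}$. Then $$\int_a^b\left[G_0(x,x,E)-G_1(x,x,E)\right]dx=\frac{Q(E)}{W_0\,(E-\alpha)},$$ where $Q(E)$ can be calculated by any one of the following formulae: $$Q(E)=(f_{r0}f_{l1})_{x=b}-(f_{r0}f_{l1})_{x=a}=(f_{l0}f_{r1})_{x=b}-(f_{l0}f_{r1})_{x=a}$$ $$=-W_0+(f_{l0}f_{r1})_{x=b}-(f_{r0}f_{l1})_{x=a}=W_0+(f_{r0}f_{l1})_{x=b}-(f_{l0}f_{r1})_{x=a}.$$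
   Context: **Spectral problem.** Let $-\infty\le a<b\le\infty$ (mostly $(a,b)=(-\infty,\infty)$ or $(0,\infty)$), let $V_0$ be a real potential and $h_0=-d^2/dx^2+V_0(x)$ on $(a,b)$ with boundary conditions $\psi(a)=\psi(b)=0$. It is assumed that $h_0$ is essentially self-adjoint in $L^2(a,b)$ and that $\mathrm{spec}\,h_0$ consists of (finitely many, infinitely many, or no) discrete eigenvalues $E_0<E_1<\dots$ and possibly a continuous part filling the positive semiaxis. **Green functions.** For $E\notin\mathrm{spec}\,h_0$, $G_0(x,y,E)$ is the integral kernel of $(h_0-E)^{-1}$; equivalently, $G_0(x,y,E)=f_{l0}(x,E)f_{r0}(y,E)/W_0$ for $x\le y$ and $G_0(y,x,E)=G_0(x,y,E)$, where $f_{l0},f_{r0}$ are non-zero solutions of $(h_0-E)f=0$ with $f_{l0}(a)=0$, $f_{r0}(b)=0$, and $W_0=W(f_{r0},f_{l0})$, which is independent of $x$. Likewise $G_1(x,y,E)$ is the kernel of $(h_1-E)^{-1}$, with $h_1$ considered on $(a,b)$ with zero boundary conditions. **SUSY partner.** Let $u$ be a real nodeless solution on $(a,b)$ of $-u''+V_0u=\alpha u$, where the real factorization constant $\alpha$ is less than or equal to the ground state energy of $h_0$ if $h_0$ has a discrete spectrum, and lower than the continuum threshold otherwise. Put $w=(\log u)'=u'/u$, $V_1=V_0-2w'$, $h_1=-d^2/dx^2+V_1$, $L=-d/dx+w$, $L^+=d/dx+w$. Then $Lu=0$, $Lh_0=h_1L$, $L^+L=h_0-\alpha$. SUSY transformations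 are required to preserve the zero boundary conditions: for $E\ne\alpha$, $f_{l1}=Lf_{l0}$ vanishes at $a$ and $f_{r1}=Lf_{r0}$ vanishes at $b$. The transformation is of one of three types: (i) deleting the ground state of $h_0$ ($\alpha=E_0$, $u=\psi_0$ the ground state eigenfunction, $\mathrm{spec}\,h_1=\mathrm{spec}\,h_0\setminus\{E_0\}$); (ii) creating a new ground state ($\alpha$ below $\mathrm{spec}\,h_0$, $1/u$ proportional to the eigenfunction of $h_1$ at energy $\alpha$, $\mathrm{spec}\,h_1=\mathrm{spec}\,h_0\cup\{\alpha\}$); (iii) isospectral ($\alpha$ below $\mathrm{spec}\,h_0$, $\mathrm{spec}\,h_1=\mathrm{spec}\,h_0$). **Conventions.** $(\cdot)_{x=a}$ and $(\cdot)_{x=b}$ denote limits as $x\to a^+$ and $x\to b^-$, these limits being understood to exist; the integral of the difference of Green functions is understood as the (possibly improper) integral over $(a,b)$, even if the integrals of $G_0(x,x,E)$ and $G_1(x,x,E)$ separately diverge. *)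

theory Defs
  imports "HOL-Analysis.Analysis"
begin

section \<open>Differential expressions on an interval\<close>

abbreviation vd :: "(real \<Rightarrow> 'a::real_normed_vector) \<Rightarrow> real \<Rightarrow> 'a" where
  "vd f \<equiv> (\<lambda>x. vector_derivative f (at x))"

text \<open>Solutions and operator domains are understood classically: functions are twice
  differentiable at every point of the open interval, and no regularity of the potential is
  assumed beyond what the existence of such solutions entails.\<close>

definition twice_differentiable_on :: "(real \<Rightarrow> 'a::real_normed_vector) \<Rightarrow> real set \<Rightarrow> bool"
    (infix \<open>twice'_differentiable'_on\<close> 50) where
  "f twice_differentiable_on I \<longleftrightarrow> (\<forall>x\<in>I. f differentiable (at x) \<and> vd f differentiable (at x))"

definition schroedinger :: "(real \<Rightarrow> real) \<Rightarrow> (real \<Rightarrow> 'a::real_normed_vector) \<Rightarrow> real \<Rightarrow> 'a" where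
  "schroedinger V f x = - vd (vd f) x + V x *\<^sub>R f x"

definition solves :: "real set \<Rightarrow> (real \<Rightarrow> real) \<Rightarrow> 'a::real_normed_field \<Rightarrow> (real \<Rightarrow> 'a) \<Rightarrow> bool" where
  "solves I V E f \<longleftrightarrow> f twice_differentiable_on I \<and> (\<forall>x\<in>I. schroedinger V f x = E * f x)"

definition wronskian :: "(real \<Rightarrow> complex) \<Rightarrow> (real \<Rightarrow> complex) \<Rightarrow> real \<Rightarrow> complex" where
  "wronskian f g x = f x * vd g x - vd f x * g x"

text \<open>The approach of a real variable to an endpoint that may be infinite.\<close>

definition left_end :: "ereal \<Rightarrow> real filter" where
  "left_end a = filtermap real_of_ereal (at_right a)"

definition right_end :: "ereal \<Rightarrow> real filter" where
  "right_end b = filtermap real_of_ereal (at_left b)"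

text \<open>The two limits of integration tend to the endpoints independently of each other.\<close>

definition has_improper_integral ::
    "ereal \<Rightarrow> ereal \<Rightarrow> (real \<Rightarrow> complex) \<Rightarrow> complex \<Rightarrow> bool" where
  "has_improper_integral a b f J \<longleftrightarrow>
     (\<forall>c d. a < ereal c \<and> c \<le> d \<and> ereal d < b \<longrightarrow> f absolutely_integrable_on {c..d}) \<and>
     ((\<lambda>(c, d). integral {c..d} f) \<longlongrightarrow> J) (left_end a \<times>\<^sub>F right_end b)"


section \<open>Unbounded operators in complex \<open>L\<^sup>2\<close>\<close>

definition L2 :: "real set \<Rightarrow> (real \<Rightarrow> complex) set" where
  "L2 I = {f \<in> borel_measurable (lebesgue_on I). integrable (lebesgue_on I) (\<lambda>x. (norm (f x))\<^sup>2)}"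

definition L2_inner :: "real set \<Rightarrow> (real \<Rightarrow> complex) \<Rightarrow> (real \<Rightarrow> complex) \<Rightarrow> complex" where
  "L2_inner I f g = integral\<^sup>L (lebesgue_on I) (\<lambda>x. cnj (f x) * g x)"

definition L2_norm :: "real set \<Rightarrow> (real \<Rightarrow> complex) \<Rightarrow> real" where
  "L2_norm I f = sqrt (integral\<^sup>L (lebesgue_on I) (\<lambda>x. (norm (f x))\<^sup>2))"

definition L2_lim :: "real set \<Rightarrow> (nat \<Rightarrow> real \<Rightarrow> complex) \<Rightarrow> (real \<Rightarrow> complex) \<Rightarrow> bool" where
  "L2_lim I F f \<longleftrightarrow> (\<lambda>n. L2_norm I (\<lambda>x. F n x - f x)) \<longlonglongrightarrow> 0"

text \<open>An operator is represented by its graph, a set of pairs of square integrable functions.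
  Elements of \<open>L\<^sup>2\<close> are functions rather than classes of functions; closures and adjoints are
  automatically invariant under changes on null sets.\<close>

type_synonym graph = "((real \<Rightarrow> complex) \<times> (real \<Rightarrow> complex)) set"

definition graph_closure :: "real set \<Rightarrow> graph \<Rightarrow> graph" where
  "graph_closure I T = {(\<psi>, \<phi>). \<psi> \<in> L2 I \<and> \<phi> \<in> L2 I \<and>
     (\<exists>\<Psi> \<Phi>. (\<forall>n. (\<Psi> n, \<Phi> n) \<in> T) \<and> L2_lim I \<Psi> \<psi> \<and> L2_lim I \<Phi> \<phi>)}"

definition graph_adjoint :: "real set \<Rightarrow> graph \<Rightarrow> graph" where
  "graph_adjoint I T = {(\<eta>, \<zeta>). \<eta> \<in> L2 I \<and> \<zeta> \<in> L2 I \<and>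
     (\<forall>(\<psi>, \<phi>)\<in>T. L2_inner I \<eta> \<phi> = L2_inner I \<zeta> \<psi>)}"

definition densely_defined :: "real set \<Rightarrow> graph \<Rightarrow> bool" where
  "densely_defined I T \<longleftrightarrow> (\<forall>f\<in>L2 I. \<exists>\<Psi>. (\<forall>n. \<Psi> n \<in> fst ` T) \<and> L2_lim I \<Psi> f)"

definition self_adjoint :: "real set \<Rightarrow> graph \<Rightarrow> bool" where
  "self_adjoint I T \<longleftrightarrow> densely_defined I T \<and> graph_adjoint I T = T"

definition essentially_self_adjoint :: "real set \<Rightarrow> graph \<Rightarrow> bool" where
  "essentially_self_adjoint I T \<longleftrightarrow> self_adjoint I (graph_closure I T)"

text \<open>For a closed operator: \<open>T - E\<close> is onto and has a bounded inverse.\<close>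

definition resolvent_set :: "real set \<Rightarrow> graph \<Rightarrow> complex set" where
  "resolvent_set I T = {E.
     (\<forall>g\<in>L2 I. \<exists>\<psi>. (\<psi>, \<lambda>x. g x + E * \<psi> x) \<in> T) \<and>
     (\<exists>C. \<forall>(\<psi>, \<phi>)\<in>T. L2_norm I \<psi> \<le> C * L2_norm I (\<lambda>x. \<phi> x - E * \<psi> x))}"

definition eigenfunction :: "real set \<Rightarrow> graph \<Rightarrow> complex \<Rightarrow> (real \<Rightarrow> complex) \<Rightarrow> bool" where
  "eigenfunction I T E \<psi> \<longleftrightarrow> (\<psi>, \<lambda>x. E * \<psi> x) \<in> T \<and> \<not> (AE x in lebesgue_on I. \<psi> x = 0)"


section \<open>The Schroedinger operator with zero boundary conditions\<close>

definition hamiltonian0 :: "ereal \<Rightarrow> ereal \<Rightarrow> (real \<Rightarrow> real) \<Rightarrow> graph" where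
  "hamiltonian0 a b V = {(\<psi>, \<phi>). \<psi> \<in> L2 (einterval a b) \<and> \<phi> \<in> L2 (einterval a b) \<and>
     \<psi> twice_differentiable_on einterval a b \<and>
     (\<psi> \<longlongrightarrow> 0) (left_end a) \<and> (\<psi> \<longlongrightarrow> 0) (right_end b) \<and>
     (\<forall>x\<in>einterval a b. \<phi> x = schroedinger V \<psi> x)}"

definition hamiltonian :: "ereal \<Rightarrow> ereal \<Rightarrow> (real \<Rightarrow> real) \<Rightarrow> graph" where
  "hamiltonian a b V = graph_closure (einterval a b) (hamiltonian0 a b V)"

definition spec :: "ereal \<Rightarrow> ereal \<Rightarrow> (real \<Rightarrow> real) \<Rightarrow> complex set" where
  "spec a b V = - resolvent_set (einterval a b) (hamiltonian a b V)"

definition discrete_eigenvalues :: "ereal \<Rightarrow> ereal \<Rightarrow> (real \<Rightarrow> real) \<Rightarrow> real set" where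
  "discrete_eigenvalues a b V = {\<nu>. complex_of_real \<nu> isolated_in spec a b V \<and>
     (\<exists>\<psi>. eigenfunction (einterval a b) (hamiltonian a b V) (complex_of_real \<nu>) \<psi>)}"

text \<open>The finiteness condition says that the discrete eigenvalues can be listed, finitely or
  infinitely many, in the form \<open>E\<^sub>0 < E\<^sub>1 < \<dots>\<close>.\<close>

definition admissible_spectrum :: "ereal \<Rightarrow> ereal \<Rightarrow> (real \<Rightarrow> real) \<Rightarrow> bool" where
  "admissible_spectrum a b V \<longleftrightarrow>
     (\<forall>\<nu>\<in>discrete_eigenvalues a b V. finite {\<mu>\<in>discrete_eigenvalues a b V. \<mu> \<le> \<nu>}) \<and>
     (spec a b V = complex_of_real ` discrete_eigenvalues a b V \<or>
      spec a b V = complex_of_real ` (discrete_eigenvalues a b V \<union> {0..}))"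

text \<open>\<open>G\<close> is the integral kernel of \<open>(h - E)\<^sup>-\<^sup>1\<close>. Continuity selects a representative, so that
  the values on the diagonal are meaningful.\<close>

definition green_function ::
    "ereal \<Rightarrow> ereal \<Rightarrow> (real \<Rightarrow> real) \<Rightarrow> complex \<Rightarrow> (real \<Rightarrow> real \<Rightarrow> complex) \<Rightarrow> bool" where
  "green_function a b V E G \<longleftrightarrow>
     continuous_on (einterval a b \<times> einterval a b) (\<lambda>(x, y). G x y) \<and>
     (\<forall>g\<in>L2 (einterval a b). \<forall>\<psi>. (\<psi>, \<lambda>x. g x + E * \<psi> x) \<in> hamiltonian a b V \<longrightarrow>
        (AE x in lebesgue_on (einterval a b).
           integrable (lebesgue_on (einterval a b)) (\<lambda>y. G x y * g y) \<and>
           \<psi> x = integral\<^sup>L (lebesgue_on (einterval a b)) (\<lambda>y. G x y * g y)))"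


section \<open>SUSY transformations\<close>

definition superpotential :: "(real \<Rightarrow> real) \<Rightarrow> real \<Rightarrow> real" where
  "superpotential u x = vd u x / u x"

definition partner_potential :: "(real \<Rightarrow> real) \<Rightarrow> (real \<Rightarrow> real) \<Rightarrow> real \<Rightarrow> real" where
  "partner_potential V u x = V x - 2 * vd (superpotential u) x"

definition susy_op :: "(real \<Rightarrow> real) \<Rightarrow> (real \<Rightarrow> complex) \<Rightarrow> real \<Rightarrow> complex" where
  "susy_op u f x = - vd f x + of_real (superpotential u x) * f x"

definition below_spec :: "ereal \<Rightarrow> ereal \<Rightarrow> (real \<Rightarrow> real) \<Rightarrow> real \<Rightarrow> bool" where
  "below_spec a b V \<alpha> \<longleftrightarrow> (\<forall>\<nu>. complex_of_real \<nu> \<in> spec a b V \<longrightarrow> \<alpha> < \<nu>)"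

definition deletes_ground_state ::
    "ereal \<Rightarrow> ereal \<Rightarrow> (real \<Rightarrow> real) \<Rightarrow> real \<Rightarrow> (real \<Rightarrow> real) \<Rightarrow> bool" where
  "deletes_ground_state a b V \<alpha> u \<longleftrightarrow>
     \<alpha> \<in> discrete_eigenvalues a b V \<and> (\<forall>\<nu>\<in>discrete_eigenvalues a b V. \<alpha> \<le> \<nu>) \<and>
     eigenfunction (einterval a b) (hamiltonian a b V) (of_real \<alpha>) (\<lambda>x. of_real (u x)) \<and>
     spec a b (partner_potential V u) = spec a b V - {complex_of_real \<alpha>}"

definition creates_ground_state ::
    "ereal \<Rightarrow> ereal \<Rightarrow> (real \<Rightarrow> real) \<Rightarrow> real \<Rightarrow> (real \<Rightarrow> real) \<Rightarrow> bool" where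
  "creates_ground_state a b V \<alpha> u \<longleftrightarrow> below_spec a b V \<alpha> \<and>
     eigenfunction (einterval a b) (hamiltonian a b (partner_potential V u))
       (of_real \<alpha>) (\<lambda>x. of_real (1 / u x)) \<and>
     spec a b (partner_potential V u) = spec a b V \<union> {complex_of_real \<alpha>}"

definition isospectral ::
    "ereal \<Rightarrow> ereal \<Rightarrow> (real \<Rightarrow> real) \<Rightarrow> real \<Rightarrow> (real \<Rightarrow> real) \<Rightarrow> bool" where
  "isospectral a b V \<alpha> u \<longleftrightarrow> below_spec a b V \<alpha> \<and>
     spec a b (partner_potential V u) = spec a b V"

text \<open>If there is no discrete eigenvalue, the continuous part is the closed positive semiaxis and
  the continuum threshold is \<open>0\<close>.\<close>

definition susy_transformation ::
    "ereal \<Rightarrow> ereal \<Rightarrow> (real \<Rightarrow> real) \<Rightarrow> real \<Rightarrow> (real \<Rightarrow> real) \<Rightarrow> bool" where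
  "susy_transformation a b V \<alpha> u \<longleftrightarrow>
     solves (einterval a b) V \<alpha> u \<and> (\<forall>x\<in>einterval a b. u x \<noteq> 0) \<and>
     (if discrete_eigenvalues a b V = {} then \<alpha> < 0
      else (\<forall>\<nu>\<in>discrete_eigenvalues a b V. \<alpha> \<le> \<nu>)) \<and>
     (\<forall>E f. E \<noteq> complex_of_real \<alpha> \<and> solves (einterval a b) V E f \<longrightarrow>
        ((f \<longlongrightarrow> 0) (left_end a) \<longrightarrow> (susy_op u f \<longlongrightarrow> 0) (left_end a)) \<and>
        ((f \<longlongrightarrow> 0) (right_end b) \<longrightarrow> (susy_op u f \<longlongrightarrow> 0) (right_end b))) \<and>
     (deletes_ground_state a b V \<alpha> u \<or> creates_ground_state a b V \<alpha> u \<or> isospectral a b V \<alpha> u)"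

end

theory Submission
  imports Defs
begin

text \<open>With \<open>g = L f\<close>, the equation \<open>h\<^sub>0 f = E f\<close> becomes the system \<open>f' = w f - g\<close>,
  \<open>g' = - w g + (E - \<alpha>) f\<close>. From it one reads off that \<open>g\<close> solves \<open>h\<^sub>1 g = E g\<close>, that the
  Wronskian is multiplied by \<open>E - \<alpha>\<close>, and that
  \<open>(f\<^sub>r\<^sub>0 f\<^sub>l\<^sub>1)' = (E - \<alpha>) f\<^sub>l\<^sub>0 f\<^sub>r\<^sub>0 - f\<^sub>l\<^sub>1 f\<^sub>r\<^sub>1\<close>, which is \<open>W\<^sub>0 (E - \<alpha>)\<close> times the difference
  of the Green functions on the diagonal.

  The point that needs an argument is that the integral kernels are given by
  \<open>f\<^sub>l f\<^sub>r / W\<close>, because the solutions are only assumed to vanish at the endpoints, not to be square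
  integrable there. Near a finite endpoint boundedness suffices. Near an infinite endpoint take
  \<open>\<eta>\<close> in the domain of \<open>h\<^sub>0\<close> with \<open>F = (h\<^sub>0 - E) \<eta>\<close> close to the conjugate of \<open>\<rho> f\<close>, where \<open>\<rho>\<close> is a
  cutoff function. As \<open>F f = (f L\<eta> - \<eta> g)'\<close>, integration against \<open>\<rho>\<close> bounds the integral of \<open>\<rho>\<^sup>2 |f|\<^sup>2\<close>
  by the size of \<open>f\<close> and \<open>g\<close> on the two unit intervals on which \<open>\<rho>\<close> varies, uniformly in the length of
  the plateau of \<open>\<rho>\<close>. The norm of \<open>\<eta>\<close> is controlled by the resolvent, that of \<open>L\<eta>\<close> by a Caccioppoli
  estimate.\<close>


section \<open>Endpoints, solutions and square integrability\<close>

lemma einterval_between: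
  assumes "a < ereal c" "ereal d < b" "c \<le> x" "x \<le> d"
  shows "x \<in> einterval a b"
proof -
  have "ereal c \<le> ereal x" "ereal x \<le> ereal d" using assms by auto
  then show ?thesis using assms(1,2) unfolding einterval_iff
    using less_le_trans[OF assms(1)] le_less_trans[OF _ assms(2)] by blast
qed

lemma einterval_Icc_subset:
  "a < ereal c \<Longrightarrow> ereal d < b \<Longrightarrow> {c..d} \<subseteq> einterval a b"
  using einterval_between[of a c d b] by auto

lemma convex_einterval: "convex (einterval a b)"
proof (subst is_interval_convex_1[symmetric], subst is_interval_1, intro ballI allI impI)
  fix c d x assume "c \<in> einterval a b" "d \<in> einterval a b" "c \<le> x \<and> x \<le> d"
  then show "x \<in> einterval a b"
    using einterval_between[of a c d b x] by (simp add: einterval_iff)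
qed

lemma sets_lebesgue_einterval [simp]: "einterval a b \<in> sets lebesgue"
  by (simp add: sets_completionI_sets)

text \<open>The endpoint filters are images of one-sided filters on the extended reals. Density of
  the reals makes the threshold a real number, which treats finite and infinite endpoints
  alike.\<close>

lemma eventually_left_end:
  assumes "a < b"
  shows "eventually P (left_end a) \<longleftrightarrow> (\<exists>c. a < ereal c \<and> (\<forall>x. a < ereal x \<and> x < c \<longrightarrow> P x))"
proof
  assume "eventually P (left_end a)"
  then obtain c where c: "a < c" "\<And>y. a < y \<Longrightarrow> y < c \<Longrightarrow> P (real_of_ereal y)"
    unfolding left_end_def eventually_filtermap eventually_at_right[OF assms] by auto
  obtain d where d: "a < ereal d" "ereal d < c"
    using ereal_dense2[OF c(1)] by blast
  have "P x" if "a < ereal x" "x < d" for x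
  proof -
    have "ereal x < c" using that(2) less_trans[OF _ d(2), of "ereal x"] by simp
    from c(2)[OF that(1) this] show ?thesis by simp
  qed
  then show "\<exists>c. a < ereal c \<and> (\<forall>x. a < ereal x \<and> x < c \<longrightarrow> P x)"
    using d by auto
next
  assume "\<exists>c. a < ereal c \<and> (\<forall>x. a < ereal x \<and> x < c \<longrightarrow> P x)"
  then obtain c where c: "a < ereal c" "\<And>x. a < ereal x \<Longrightarrow> x < c \<Longrightarrow> P x" by auto
  have "P (real_of_ereal y)" if "a < y" "y < ereal c" for y
    using that c(2)[of "real_of_ereal y"] by (cases y) simp_all
  with c(1) show "eventually P (left_end a)"
    unfolding left_end_def eventually_filtermap eventually_at_right[OF assms] by auto
qed

lemma eventually_right_end:
  assumes "a < b"
  shows "eventually P (right_end b) \<longleftrightarrow> (\<exists>c. ereal c < b \<and> (\<forall>x. ereal x < b \<and> c < x \<longrightarrow> P x))"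
proof
  assume "eventually P (right_end b)"
  then obtain c where c: "c < b" "\<And>y. c < y \<Longrightarrow> y < b \<Longrightarrow> P (real_of_ereal y)"
    unfolding right_end_def eventually_filtermap eventually_at_left[OF assms] by auto
  obtain d where d: "c < ereal d" "ereal d < b"
    using ereal_dense2[OF c(1)] by blast
  have "P x" if "ereal x < b" "d < x" for x
  proof -
    have "c < ereal x" using that(2) less_trans[OF d(1), of "ereal x"] by simp
    from c(2)[OF this that(1)] show ?thesis by simp
  qed
  then show "\<exists>c. ereal c < b \<and> (\<forall>x. ereal x < b \<and> c < x \<longrightarrow> P x)"
    using d by auto
next
  assume "\<exists>c. ereal c < b \<and> (\<forall>x. ereal x < b \<and> c < x \<longrightarrow> P x)"
  then obtain c where c: "ereal c < b" "\<And>x. ereal x < b \<Longrightarrow> c < x \<Longrightarrow> P x" by auto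
  have "P (real_of_ereal y)" if "y < b" "ereal c < y" for y
    using that c(2)[of "real_of_ereal y"] by (cases y) simp_all
  with c(1) show "eventually P (right_end b)"
    unfolding right_end_def eventually_filtermap eventually_at_left[OF assms] by auto
qed

lemma left_end_nontrivial:
  assumes "a < b" shows "left_end a \<noteq> bot"
proof -
  have "\<exists>x. a < ereal x \<and> x < c" if "a < ereal c" for c
    using ereal_dense2[OF that] by (metis less_ereal.simps(1))
  then show ?thesis
    unfolding trivial_limit_def eventually_left_end[OF assms] by auto
qed

lemma right_end_nontrivial:
  assumes "a < b" shows "right_end b \<noteq> bot"
proof -
  have "\<exists>x. ereal x < b \<and> c < x" if "ereal c < b" for c
    using ereal_dense2[OF that] by (metis less_ereal.simps(1))
  then show ?thesis
    unfolding trivial_limit_def eventually_right_end[OF assms] by auto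
qed

section \<open>Classical solutions\<close>

text \<open>\<open>vd f\<close> is known to agree with \<open>f1\<close> only on \<open>I\<close>;
  openness supplies the neighbourhood of agreement that a second differentiation requires.\<close>

lemma twice_differentiable_onI:
  assumes "open I" and 1: "\<And>x. x \<in> I \<Longrightarrow> (f has_vector_derivative f1 x) (at x)"
    and 2: "\<And>x. x \<in> I \<Longrightarrow> (f1 has_vector_derivative f2 x) (at x)"
  shows "f twice_differentiable_on I" and "\<And>x. x \<in> I \<Longrightarrow> vd f x = f1 x"
    and "\<And>x. x \<in> I \<Longrightarrow> vd (vd f) x = f2 x"
proof -
  show eq: "vd f x = f1 x" if "x \<in> I" for x
    by (rule vector_derivative_at[OF 1[OF that]])
  have 3: "(vd f has_vector_derivative f2 x) (at x)" if "x \<in> I" for x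
    by (rule has_vector_derivative_transform_within_open[OF 2[OF that] \<open>open I\<close> that]) (simp add: eq)
  show "vd (vd f) x = f2 x" if "x \<in> I" for x
    by (rule vector_derivative_at[OF 3[OF that]])
  show "f twice_differentiable_on I"
    unfolding twice_differentiable_on_def
    using 1 3 by (auto intro: differentiableI_vector)
qed

lemma twice_differentiable_onD:
  assumes "f twice_differentiable_on I" "x \<in> I"
  shows "(f has_vector_derivative vd f x) (at x)" "(vd f has_vector_derivative vd (vd f) x) (at x)"
  using assms unfolding twice_differentiable_on_def by (auto simp: vector_derivative_works)

lemma solvesI:
  assumes "open I" "\<And>x. x \<in> I \<Longrightarrow> (f has_vector_derivative f1 x) (at x)"
    "\<And>x. x \<in> I \<Longrightarrow> (f1 has_vector_derivative V x *\<^sub>R f x - E * f x) (at x)"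
  shows "solves I V E f"
  using twice_differentiable_onI[OF assms] unfolding solves_def schroedinger_def by auto

lemma solvesD:
  assumes "solves I V E f" "x \<in> I"
  shows "(f has_vector_derivative vd f x) (at x)"
    "(vd f has_vector_derivative V x *\<^sub>R f x - E * f x) (at x)"
proof -
  from assms have tw: "f twice_differentiable_on I" and eq: "- vd (vd f) x + V x *\<^sub>R f x = E * f x"
    by (auto simp: solves_def schroedinger_def)
  have "vd (vd f) x = V x *\<^sub>R f x - E * f x"
    using eq by (simp add: algebra_simps)
  then show "(f has_vector_derivative vd f x) (at x)"
    "(vd f has_vector_derivative V x *\<^sub>R f x - E * f x) (at x)"
    using twice_differentiable_onD[OF tw assms(2)] by simp_all
qed

lemma continuous_on_vector_derivative:
  assumes "\<And>x. x \<in> S \<Longrightarrow> (f has_vector_derivative f' x) (at x)"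
  shows "continuous_on S f"
  using assms by (meson continuous_at_imp_continuous_on has_vector_derivative_continuous)

section \<open>Square integrable functions\<close>

lemma L2_iff:
  assumes "I \<in> sets lebesgue"
  shows "f \<in> L2 I \<longleftrightarrow> f \<in> borel_measurable (lebesgue_on I) \<and> (\<lambda>x. (norm (f x))\<^sup>2) absolutely_integrable_on I"
  unfolding L2_def set_integrable_def using assms by (auto simp: integrable_restrict_space)

lemma L2_norm_square:
  assumes "f \<in> L2 I" "I \<in> sets lebesgue"
  shows "(L2_norm I f)\<^sup>2 = integral I (\<lambda>x. (norm (f x))\<^sup>2)"
proof -
  have "(L2_norm I f)\<^sup>2 = integral\<^sup>L (lebesgue_on I) (\<lambda>x. (norm (f x))\<^sup>2)"
    unfolding L2_norm_def by (simp add: integral_nonneg_AE)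
  also have "\<dots> = integral I (\<lambda>x. (norm (f x))\<^sup>2)"
    using assms by (intro lebesgue_integral_eq_integral) (auto simp: L2_def)
  finally show ?thesis .
qed

text \<open>The elementary \<open>(s + t)^2 \<le> 2 s^2 + 2 t^2\<close> takes the place of
  Minkowski's inequality: the later bounds are all for squared norms, where a factor 2 is
  harmless.\<close>

lemma L2_linear:
  assumes "f \<in> L2 I" "g \<in> L2 I"
  shows "(\<lambda>x. p * f x + q * g x) \<in> L2 I"
    and "(L2_norm I (\<lambda>x. p * f x + q * g x))\<^sup>2 \<le>
      2 * (norm p)\<^sup>2 * (L2_norm I f)\<^sup>2 + 2 * (norm q)\<^sup>2 * (L2_norm I g)\<^sup>2"
proof -
  have m: "f \<in> borel_measurable (lebesgue_on I)" "g \<in> borel_measurable (lebesgue_on I)"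
    using assms by (auto simp: L2_def)
  have i: "integrable (lebesgue_on I) (\<lambda>x. 2 * (norm p)\<^sup>2 * (norm (f x))\<^sup>2 + 2 * (norm q)\<^sup>2 * (norm (g x))\<^sup>2)"
    using assms by (auto simp: L2_def)
  have le: "(norm (p * x + q * y))\<^sup>2 \<le> 2 * (norm p)\<^sup>2 * (norm x)\<^sup>2 + 2 * (norm q)\<^sup>2 * (norm y)\<^sup>2" for x y :: complex
  proof -
    have "(norm (p * x + q * y))\<^sup>2 \<le> (norm (p * x) + norm (q * y))\<^sup>2"
      by (intro power_mono norm_triangle_ineq) auto
    also have "\<dots> \<le> 2 * (norm (p * x))\<^sup>2 + 2 * (norm (q * y))\<^sup>2"
      using sum_squares_bound[of "norm (p * x)" "norm (q * y)"] by (simp add: power2_sum)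
    finally show ?thesis by (simp add: norm_mult power_mult_distrib)
  qed
  have "integrable (lebesgue_on I) (\<lambda>x. (norm (p * f x + q * g x))\<^sup>2)"
    by (rule Bochner_Integration.integrable_bound[OF i]) (use m le in auto)
  then show "(\<lambda>x. p * f x + q * g x) \<in> L2 I" using m by (auto simp: L2_def)
  have "integral\<^sup>L (lebesgue_on I) (\<lambda>x. (norm (p * f x + q * g x))\<^sup>2)
    \<le> integral\<^sup>L (lebesgue_on I) (\<lambda>x. 2 * (norm p)\<^sup>2 * (norm (f x))\<^sup>2 + 2 * (norm q)\<^sup>2 * (norm (g x))\<^sup>2)"
    by (intro integral_mono i le) fact
  also have "\<dots> = 2 * (norm p)\<^sup>2 * integral\<^sup>L (lebesgue_on I) (\<lambda>x. (norm (f x))\<^sup>2)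
      + 2 * (norm q)\<^sup>2 * integral\<^sup>L (lebesgue_on I) (\<lambda>x. (norm (g x))\<^sup>2)"
    using assms by (subst Bochner_Integration.integral_add) (auto simp: L2_def)
  finally show "(L2_norm I (\<lambda>x. p * f x + q * g x))\<^sup>2 \<le>
      2 * (norm p)\<^sup>2 * (L2_norm I f)\<^sup>2 + 2 * (norm q)\<^sup>2 * (L2_norm I g)\<^sup>2"
    unfolding L2_norm_def by simp
qed

text \<open>Monotone convergence along an exhaustion by compact intervals turns a uniform bound on
  the compact integrals into integrability up to the endpoints.\<close>

lemma nonneg_integrable_on_einterval:
  fixes h :: "real \<Rightarrow> real"
  assumes "a < b" and cont: "continuous_on (einterval a b) h" and nn: "\<And>x. 0 \<le> h x"
    and M: "\<And>s t. a < ereal s \<Longrightarrow> s \<le> t \<Longrightarrow> ereal t < b \<Longrightarrow> integral {s..t} h \<le> M"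
  shows "h absolutely_integrable_on einterval a b"
proof -
  obtain l u :: "nat \<Rightarrow> real" where ul: "einterval a b = (\<Union>i. {l i..u i})" "incseq u" "decseq l"
    "\<And>i. l i < u i" "\<And>i. a < l i" "\<And>i. u i < b"
    by (rule einterval_Icc_approximation[OF \<open>a < b\<close>]) (rule that)
  define H where "H k x = (if x \<in> {l k..u k} then h x else 0)" for k x
  have sub: "{l k..u k} \<subseteq> einterval a b" for k
    unfolding ul(1) by blast
  have int: "h integrable_on {l k..u k}" for k
    by (intro integrable_continuous_real continuous_on_subset[OF cont sub])
  have eq: "integral (einterval a b) (H k) = integral {l k..u k} h" for k
    unfolding H_def integral_restrict_Int Int_absorb2[OF sub[of k]] ..
  have "h integrable_on einterval a b \<and> ((\<lambda>k. integral (einterval a b) (H k)) \<longlonglongrightarrow> integral (einterval a b) h)"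
  proof (rule monotone_convergence_increasing)
    show "H k integrable_on einterval a b" for k
      unfolding H_def integrable_restrict_Int Int_absorb2[OF sub[of k]] by (rule int)
    show "H k x \<le> H (Suc k) x" for k x
      using incseq_SucD[OF ul(2), of k] decseq_SucD[OF ul(3), of k] nn[of x] unfolding H_def by simp
    show "(\<lambda>k. H k x) \<longlonglongrightarrow> h x" if "x \<in> einterval a b" for x
    proof -
      from that obtain i where "x \<in> {l i..u i}" unfolding ul(1) by blast
      then have i: "l i \<le> x" "x \<le> u i" by simp_all
      have "H k x = h x" if "i \<le> k" for k
        using incseqD[OF ul(2) that] decseqD[OF ul(3) that] i unfolding H_def by simp
      then show ?thesis
        by (intro tendsto_eventually eventually_sequentiallyI[of i]) auto
    qed
    have "\<bar>integral {l k..u k} h\<bar> \<le> M" for k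
      using M[OF ul(5) less_imp_le[OF ul(4)] ul(6), of k] integral_nonneg[OF int, of k, OF nn] by linarith
    then show "bounded (range (\<lambda>k. integral (einterval a b) (H k)))"
      unfolding bounded_iff eq by (intro exI[of _ M]) auto
  qed
  then show ?thesis
    by (intro nonnegative_absolutely_integrable_1) (use nn in auto)
qed


section \<open>The Green function on the diagonal\<close>

text \<open>On the compact middle piece continuity suffices, so the behaviour at the two endpoints
  can be checked separately.\<close>

lemma L2_einterval_split:
  assumes cont: "continuous_on (einterval a b) f" and "a < ereal c" "c \<le> d" "ereal d < b"
    and l: "(\<lambda>x. (norm (f x))\<^sup>2) absolutely_integrable_on einterval a c"
    and r: "(\<lambda>x. (norm (f x))\<^sup>2) absolutely_integrable_on einterval d b"
  shows "f \<in> L2 (einterval a b)"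
proof -
  have sub: "{c..d} \<subseteq> einterval a b"
    by (rule einterval_Icc_subset) fact+
  have "(\<lambda>x. (norm (f x))\<^sup>2) absolutely_integrable_on {c..d}"
    by (intro absolutely_integrable_continuous_real continuous_intros continuous_on_subset[OF cont sub])
  with l r have "(\<lambda>x. (norm (f x))\<^sup>2) absolutely_integrable_on ((einterval a c \<union> {c..d}) \<union> einterval d b)"
    by (intro set_integrable_Un) auto
  moreover have "(einterval a c \<union> {c..d}) \<union> einterval d b = einterval a b"
  proof -
    have "x \<in> einterval a b" if "x \<in> einterval a c" for x
      using that einterval_between[of a x d b x] assms(3) less_le_trans
      by (auto simp: einterval_iff intro: le_less_trans[OF _ \<open>ereal d < b\<close>])
    moreover have "x \<in> einterval a b" if "x \<in> einterval d b" for x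
      using that less_trans[OF \<open>a < ereal c\<close>, of "ereal x"] assms(3) by (auto simp: einterval_iff)
    ultimately show ?thesis
      using sub by (auto simp: einterval_iff)
  qed
  ultimately show ?thesis
    using cont by (auto simp: L2_iff intro: continuous_imp_measurable_on_sets_lebesgue)
qed

text \<open>Variation of parameters. The solution \<open>\<psi>\<close> of
  \<open>(h - E) \<psi> = k\<close> is a multiple of \<open>fl\<close> left of \<open>c\<close> and
  of \<open>fr\<close> right of \<open>d\<close>, so it inherits their boundary values and square
  integrability. Hence it lies in the classical domain, not merely in its closure.\<close>

lemma green_kernel_preimage:
  fixes fl fr k :: "real \<Rightarrow> complex"
  assumes "a < b"
    and fl: "solves (einterval a b) V E fl" "(fl \<longlongrightarrow> 0) (left_end a)"
      "\<And>c. c \<in> einterval a b \<Longrightarrow> (\<lambda>x. (norm (fl x))\<^sup>2) absolutely_integrable_on einterval a c"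
    and fr: "solves (einterval a b) V E fr" "(fr \<longlongrightarrow> 0) (right_end b)"
      "\<And>c. c \<in> einterval a b \<Longrightarrow> (\<lambda>x. (norm (fr x))\<^sup>2) absolutely_integrable_on einterval c b"
    and W: "\<And>x. x \<in> einterval a b \<Longrightarrow> wronskian fr fl x = W" "W \<noteq> 0"
    and k: "continuous_on UNIV k" "\<And>x. x \<notin> {c<..<d} \<Longrightarrow> k x = 0"
    and cd: "a < ereal c" "c \<le> d" "ereal d < b"
  shows "\<exists>\<psi>. (\<psi>, \<lambda>x. k x + E * \<psi> x) \<in> hamiltonian0 a b V \<and> k \<in> L2 (einterval a b) \<and>
    (\<forall>x\<in>{c..d}. ((\<lambda>y. fl (min x y) * fr (max x y) / W * k y) has_integral \<psi> x) {c..d})"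
proof -
  let ?I = "einterval a b"
  have cI: "c \<in> ?I" "d \<in> ?I"
    using cd einterval_between[OF cd(1,3)] by auto
  note fl' = solvesD[OF fl(1)] and fr' = solvesD[OF fr(1)]
  have cont: "continuous_on ?I fl" "continuous_on ?I fr"
    using continuous_on_vector_derivative[OF fl'(1)] continuous_on_vector_derivative[OF fr'(1)] by auto
  have at: "isCont fl x" "isCont fr x" "isCont k x" if "x \<in> ?I" for x
    using cont k(1) that by (auto simp: continuous_on_eq_continuous_at)
  have cont_P0: "isCont (\<lambda>x. fl x * k x) x" if "a < ereal x" "ereal x < b" for x
    using at that by (auto simp: einterval_iff intro!: continuous_intros)
  obtain P0 where "\<forall>x. a < ereal x \<longrightarrow> ereal x < b \<longrightarrow> (P0 has_vector_derivative fl x * k x) (at x)"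
    using einterval_antiderivative[OF \<open>a < b\<close> cont_P0] by blast
  then have P0: "(P0 has_vector_derivative fl x * k x) (at x)" if "x \<in> ?I" for x
    using that by (simp add: einterval_iff)
  have cont_S0: "isCont (\<lambda>x. fr x * k x) x" if "a < ereal x" "ereal x < b" for x
    using at that by (auto simp: einterval_iff intro!: continuous_intros)
  obtain S0 where "\<forall>x. a < ereal x \<longrightarrow> ereal x < b \<longrightarrow> (S0 has_vector_derivative fr x * k x) (at x)"
    using einterval_antiderivative[OF \<open>a < b\<close> cont_S0] by blast
  then have S0: "(S0 has_vector_derivative fr x * k x) (at x)" if "x \<in> ?I" for x
    using that by (simp add: einterval_iff)
  have ftc: "((\<lambda>x. f x * k x) has_integral (F t - F s)) {s..t}"
    if "\<And>x. x \<in> ?I \<Longrightarrow> (F has_vector_derivative f x * k x) (at x)" "s \<in> ?I" "t \<in> ?I" "s \<le> t" for F f s t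
    by (rule fundamental_theorem_of_calculus[OF \<open>s \<le> t\<close>], rule has_vector_derivative_at_within, rule that(1))
      (use that(2,3) einterval_between[of a s t b] in \<open>auto simp: einterval_iff\<close>)
  \<comment> \<open>Left of \<open>c\<close> and right of \<open>d\<close> the integrand is zero, so
    the antiderivatives are constant there.\<close>
  have const: "F t = F s"
    if "\<And>x. x \<in> ?I \<Longrightarrow> (F has_vector_derivative f x * k x) (at x)" "s \<in> ?I" "t \<in> ?I" "s \<le> t"
      "t \<le> c \<or> d \<le> s" for F f s t
  proof -
    have "((\<lambda>x. f x * k x) has_integral 0) {s..t}"
      using k(2) that(5) by (intro has_integral_is_0) auto
    with ftc[OF that(1-4)] have "F t - F s = 0" by (rule has_integral_unique)
    then show ?thesis by simp
  qed
  \<comment> \<open>The constants are chosen so that \<open>P\<close> vanishes left of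
    \<open>c\<close> and \<open>S\<close> right of \<open>d\<close>; only the solution with the
    correct boundary value survives on either side.\<close>
  define P where "P x = P0 x - P0 c" for x
  define S where "S x = S0 d - S0 x" for x
  have dP: "(P has_vector_derivative fl x * k x) (at x)" if "x \<in> ?I" for x
    unfolding P_def using P0[OF that] by (auto intro!: derivative_eq_intros)
  have dS: "(S has_vector_derivative - (fr x * k x)) (at x)" if "x \<in> ?I" for x
    unfolding S_def using S0[OF that] by (auto intro!: derivative_eq_intros)
  define \<psi> where "\<psi> x = (fr x * P x + fl x * S x) / W" for x
  define \<psi>1 where "\<psi>1 x = (vd fr x * P x + vd fl x * S x) / W" for x
  have d1: "(\<psi> has_vector_derivative \<psi>1 x) (at x)" if "x \<in> ?I" for x
    unfolding \<psi>_def \<psi>1_def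
    by (rule derivative_eq_intros fl'(1) fr'(1) dP dS that refl)+ (simp add: algebra_simps)
  have d2: "(\<psi>1 has_vector_derivative (V x *\<^sub>R \<psi> x - E * \<psi> x - k x)) (at x)" if "x \<in> ?I" for x
  proof -
    \<comment> \<open>The terms containing \<open>k\<close> combine to \<open>- k\<close> times the
      Wronskian divided by \<open>W\<close>, which is \<open>- k\<close>.\<close>
    have "((V x *\<^sub>R fr x - E * fr x) * P x + vd fr x * (fl x * k x)
         + ((V x *\<^sub>R fl x - E * fl x) * S x + vd fl x * (- (fr x * k x)))) / W
       = V x *\<^sub>R \<psi> x - E * \<psi> x - (fr x * vd fl x - vd fr x * fl x) * k x / W"
      using W(2) by (simp add: \<psi>_def field_simps scaleR_conv_of_real)
    also have "\<dots> = V x *\<^sub>R \<psi> x - E * \<psi> x - k x"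
      using W(1)[OF that] \<open>W \<noteq> 0\<close> by (simp add: wronskian_def)
    finally have eq: "((V x *\<^sub>R fr x - E * fr x) * P x + vd fr x * (fl x * k x)
         + ((V x *\<^sub>R fl x - E * fl x) * S x + vd fl x * (- (fr x * k x)))) / W
       = V x *\<^sub>R \<psi> x - E * \<psi> x - k x" .
    have "(\<psi>1 has_vector_derivative ((V x *\<^sub>R fr x - E * fr x) * P x + vd fr x * (fl x * k x)
         + ((V x *\<^sub>R fl x - E * fl x) * S x + vd fl x * (- (fr x * k x)))) / W) (at x)"
      unfolding \<psi>1_def
      by (rule derivative_eq_intros fl'(2) fr'(2) dP dS that refl)+ (simp add: algebra_simps)
    then show ?thesis unfolding eq .
  qed
  note tw = twice_differentiable_onI[OF open_einterval d1 d2]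
  have c\<psi>: "continuous_on ?I \<psi>"
    by (rule continuous_on_vector_derivative[OF d1])
  have left: "\<psi> x = S c / W * fl x" if "a < ereal x" "x \<le> c" for x
  proof -
    have "x \<in> ?I" using that cd einterval_between[of a x c b x] cI by (auto simp: einterval_iff)
    then have "P0 c = P0 x" "S0 c = S0 x"
      using const[OF P0 _ cI(1) \<open>x \<le> c\<close>] const[OF S0 _ cI(1) \<open>x \<le> c\<close>] by auto
    then show ?thesis by (simp add: \<psi>_def P_def S_def)
  qed
  have right: "\<psi> x = P d / W * fr x" if "ereal x < b" "d \<le> x" for x
  proof -
    have "x \<in> ?I" using that cd einterval_between[of a d x b x] cI by (auto simp: einterval_iff)
    then have "P0 x = P0 d" "S0 x = S0 d"
      using const[OF P0 cI(2) _ \<open>d \<le> x\<close>] const[OF S0 cI(2) _ \<open>d \<le> x\<close>] by auto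
    then show ?thesis by (simp add: \<psi>_def P_def S_def)
  qed
  have "\<psi> \<in> L2 ?I"
  proof (rule L2_einterval_split[OF c\<psi> cd])
    have "(\<lambda>x. (norm (S c / W))\<^sup>2 * (norm (fl x))\<^sup>2) absolutely_integrable_on einterval a c"
      using fl(3)[OF cI(1)] by simp
    then show "(\<lambda>x. (norm (\<psi> x))\<^sup>2) absolutely_integrable_on einterval a c"
      by (rule set_integrable_cong[THEN iffD1, rotated -1])
        (auto simp: einterval_iff left norm_mult norm_divide power_mult_distrib power_divide)
    have "(\<lambda>x. (norm (P d / W))\<^sup>2 * (norm (fr x))\<^sup>2) absolutely_integrable_on einterval d b"
      using fr(3)[OF cI(2)] by simp
    then show "(\<lambda>x. (norm (\<psi> x))\<^sup>2) absolutely_integrable_on einterval d b"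
      by (rule set_integrable_cong[THEN iffD1, rotated -1])
        (auto simp: einterval_iff right norm_mult norm_divide power_mult_distrib power_divide)
  qed
  have kL2: "k \<in> L2 ?I"
  proof (rule L2_einterval_split[OF _ cd])
    show "continuous_on ?I k" using k(1) continuous_on_subset by blast
    have z: "(\<lambda>x::real. 0::real) absolutely_integrable_on A" for A by simp
    show "(\<lambda>x. (norm (k x))\<^sup>2) absolutely_integrable_on einterval a c"
      using z by (rule set_integrable_cong[THEN iffD1, rotated -1]) (auto simp: einterval_iff k(2))
    show "(\<lambda>x. (norm (k x))\<^sup>2) absolutely_integrable_on einterval d b"
      using z by (rule set_integrable_cong[THEN iffD1, rotated -1]) (auto simp: einterval_iff k(2))
  qed
  have lim_l: "(\<psi> \<longlongrightarrow> 0) (left_end a)"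
  proof (rule Lim_transform_eventually)
    show "((\<lambda>x. S c / W * fl x) \<longlongrightarrow> 0) (left_end a)"
      using tendsto_mult[OF tendsto_const fl(2), of "S c / W"] by simp
    show "eventually (\<lambda>x. S c / W * fl x = \<psi> x) (left_end a)"
      unfolding eventually_left_end[OF \<open>a < b\<close>] using cd(1) left by (intro exI[of _ c]) auto
  qed
  have lim_r: "(\<psi> \<longlongrightarrow> 0) (right_end b)"
  proof (rule Lim_transform_eventually)
    show "((\<lambda>x. P d / W * fr x) \<longlongrightarrow> 0) (right_end b)"
      using tendsto_mult[OF tendsto_const fr(2), of "P d / W"] by simp
    show "eventually (\<lambda>x. P d / W * fr x = \<psi> x) (right_end b)"
      unfolding eventually_right_end[OF \<open>a < b\<close>] using cd(3) right by (intro exI[of _ d]) auto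
  qed
  have "(\<lambda>x. 1 * k x + E * \<psi> x) \<in> L2 ?I"
    by (rule L2_linear(1)) fact+
  then have dom: "(\<psi>, \<lambda>x. k x + E * \<psi> x) \<in> hamiltonian0 a b V"
    using \<open>\<psi> \<in> L2 ?I\<close> tw lim_l lim_r
    unfolding hamiltonian0_def schroedinger_def by (auto simp: algebra_simps)
  \<comment> \<open>Splitting at \<open>x\<close> resolves \<open>min\<close> and
    \<open>max\<close>: the part below \<open>x\<close> gives the term with \<open>P\<close>, the
    part above gives the term with \<open>S\<close>.\<close>
  have ker: "((\<lambda>y. fl (min x y) * fr (max x y) / W * k y) has_integral \<psi> x) {c..d}"
    if x: "x \<in> {c..d}" for x
  proof -
    have xI: "x \<in> ?I" using x einterval_between[OF cd(1,3)] by auto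
    have "((\<lambda>y. fr x / W * (fl y * k y)) has_integral fr x / W * P x) {c..x}"
      unfolding P_def using ftc[OF P0 cI(1) xI] x by (intro has_integral_mult_right) auto
    then have 1: "((\<lambda>y. fl (min x y) * fr (max x y) / W * k y) has_integral fr x / W * P x) {c..x}"
      by (rule has_integral_eq[rotated]) (auto simp: min_def max_def mult_ac)
    have "((\<lambda>y. fl x / W * (fr y * k y)) has_integral fl x / W * S x) {x..d}"
      unfolding S_def using ftc[OF S0 xI cI(2)] x by (intro has_integral_mult_right) auto
    then have 2: "((\<lambda>y. fl (min x y) * fr (max x y) / W * k y) has_integral fl x / W * S x) {x..d}"
      by (rule has_integral_eq[rotated]) (auto simp: min_def max_def mult_ac)
    show ?thesis
      using has_integral_combine[OF _ _ 1 2] x by (simp add: \<psi>_def add_divide_distrib)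
  qed
  show ?thesis
    using dom kL2 ker by blast
qed

lemma graph_subset_closure:
  assumes "T \<subseteq> L2 I \<times> L2 I" shows "T \<subseteq> graph_closure I T"
proof
  fix p assume "p \<in> T"
  moreover obtain \<psi> \<phi> where p: "p = (\<psi>, \<phi>)" by force
  ultimately show "p \<in> graph_closure I T"
    using assms unfolding graph_closure_def p
    by (intro CollectI case_prodI conjI exI[of _ "\<lambda>_. \<psi>"] exI[of _ "\<lambda>_. \<phi>"])
      (auto simp: L2_lim_def L2_norm_def)
qed

lemma hamiltonian0_subset: "hamiltonian0 a b V \<subseteq> hamiltonian a b V"
  unfolding hamiltonian_def by (rule graph_subset_closure) (auto simp: hamiltonian0_def)

text \<open>Both kernels send a test function \<open>k\<close> to the same \<open>\<psi>\<close>,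
  the one of \<open>green_kernel_preimage\<close>. If their continuous difference \<open>D\<close>
  were nonzero at \<open>(z, z)\<close>, it would stay close to \<open>D z z\<close> on a small
  square, and a nonnegative \<open>k\<close> supported in its side would detect it.\<close>

lemma green_function_diagonal:
  fixes fl fr :: "real \<Rightarrow> complex"
  assumes "a < b" and G: "green_function a b V E G"
    and fl: "solves (einterval a b) V E fl" "(fl \<longlongrightarrow> 0) (left_end a)"
      "\<And>c. c \<in> einterval a b \<Longrightarrow> (\<lambda>x. (norm (fl x))\<^sup>2) absolutely_integrable_on einterval a c"
    and fr: "solves (einterval a b) V E fr" "(fr \<longlongrightarrow> 0) (right_end b)"
      "\<And>c. c \<in> einterval a b \<Longrightarrow> (\<lambda>x. (norm (fr x))\<^sup>2) absolutely_integrable_on einterval c b"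
    and W: "\<And>x. x \<in> einterval a b \<Longrightarrow> wronskian fr fl x = W" "W \<noteq> 0"
    and z: "z \<in> einterval a b"
  shows "G z z = fl z * fr z / W"
proof (rule ccontr)
  let ?I = "einterval a b"
  assume neq: "G z z \<noteq> fl z * fr z / W"
  define K where "K x y = fl (min x y) * fr (max x y) / W" for x y
  define D where "D x y = G x y - K x y" for x y
  have D0: "D z z \<noteq> 0" using neq by (simp add: D_def K_def)
  have cont: "continuous_on ?I fl" "continuous_on ?I fr"
    using continuous_on_vector_derivative[OF solvesD(1)[OF fl(1)]]
      continuous_on_vector_derivative[OF solvesD(1)[OF fr(1)]] by auto
  have mm: "min x y \<in> ?I" "max x y \<in> ?I" if "x \<in> ?I" "y \<in> ?I" for x y
    using that by (auto simp: min_def max_def)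
  have cK: "continuous_on (?I \<times> ?I) (\<lambda>p. K (fst p) (snd p))"
    unfolding K_def
    by (intro continuous_intros continuous_on_compose2[OF cont(1)] continuous_on_compose2[OF cont(2)])
      (auto simp: W(2) mm)
  have cG: "continuous_on (?I \<times> ?I) (\<lambda>p. G (fst p) (snd p))"
    using G by (simp add: green_function_def case_prod_beta')
  have cD: "continuous_on (?I \<times> ?I) (\<lambda>p. D (fst p) (snd p))"
    unfolding D_def by (intro continuous_intros cK cG)
  have "open (?I \<times> ?I)" by (intro open_Times) auto
  with cD z have "isCont (\<lambda>p. D (fst p) (snd p)) (z, z)"
    by (auto simp: continuous_on_eq_continuous_at)
  then obtain e1 where e1: "e1 > 0"
    "\<And>p. dist p (z, z) < e1 \<Longrightarrow> dist (D (fst p) (snd p)) (D z z) < norm (D z z) / 2"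
    unfolding continuous_at_eps_delta using D0 by (auto dest: spec[of _ "norm (D z z) / 2"])
  obtain e2 where e2: "e2 > 0" "cball z e2 \<subseteq> ?I"
    using open_contains_cball[of ?I] z by auto
  \<comment> \<open>A point of the square has distance at most \<open>2 * e < e1\<close> from
    \<open>(z, z)\<close>; \<open>e2\<close> keeps the square inside the domain.\<close>
  define e where "e = min (e1 / 3) e2"
  have e: "e > 0" "{z - e..z + e} \<subseteq> ?I"
    using e1(1) e2 subset_trans[of "{z - e..z + e}" "cball z e2" ?I]
    by (auto simp: e_def cball_eq_atLeastAtMost)
  have near: "norm (D x y - D z z) < norm (D z z) / 2" if "x \<in> {z - e..z + e}" "y \<in> {z - e..z + e}" for x y
  proof -
    have "dist (x, y) (z, z) \<le> dist x z + dist y z"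
      unfolding dist_Pair_Pair by (intro sqrt_sum_squares_le_sum) auto
    also have "\<dots> \<le> e + e" using that by (auto simp: dist_real_def)
    also have "\<dots> < e1" using e1(1) by (auto simp: e_def)
    finally show ?thesis using e1(2)[of "(x, y)"] by (simp add: dist_norm)
  qed
  \<comment> \<open>A tent function: continuous, zero outside the open interval, and equal to
    \<open>e > 0\<close> at its centre \<open>z\<close>.\<close>
  define k :: "real \<Rightarrow> complex" where "k y = of_real (max 0 (e - \<bar>y - z\<bar>))" for y
  have k: "continuous_on UNIV k" "\<And>x. x \<notin> {z - e<..<z + e} \<Longrightarrow> k x = 0"
    unfolding k_def by (auto intro!: continuous_intros)
  have ze: "a < ereal (z - e)" "z - e \<le> z + e" "ereal (z + e) < b"
    using e subsetD[OF e(2), of "z - e"] subsetD[OF e(2), of "z + e"] by (auto simp: einterval_iff)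
  have "\<exists>\<psi>. (\<psi>, \<lambda>x. k x + E * \<psi> x) \<in> hamiltonian0 a b V \<and> k \<in> L2 ?I \<and>
    (\<forall>x\<in>{z - e..z + e}. ((\<lambda>y. K x y * k y) has_integral \<psi> x) {z - e..z + e})"
    unfolding K_def by (rule green_kernel_preimage) (fact assms k ze)+
  then obtain \<psi> where \<psi>: "(\<psi>, \<lambda>x. k x + E * \<psi> x) \<in> hamiltonian0 a b V" "k \<in> L2 ?I"
    "\<And>x. x \<in> {z - e..z + e} \<Longrightarrow> ((\<lambda>y. K x y * k y) has_integral \<psi> x) {z - e..z + e}"
    by blast
  have ae: "AE x in lebesgue_on ?I. integrable (lebesgue_on ?I) (\<lambda>y. G x y * k y) \<and>
      \<psi> x = integral\<^sup>L (lebesgue_on ?I) (\<lambda>y. G x y * k y)"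
    using G \<psi>(1,2) hamiltonian0_subset[of a b V] unfolding green_function_def by blast
  \<comment> \<open>The kernel identity holds for almost every \<open>x\<close>, and the interval
    has positive measure, so it holds at some \<open>x\<close> in it.\<close>
  have "\<exists>x\<in>{z - e..z + e}. integrable (lebesgue_on ?I) (\<lambda>y. G x y * k y) \<and>
      \<psi> x = integral\<^sup>L (lebesgue_on ?I) (\<lambda>y. G x y * k y)"
  proof (rule ccontr)
    assume no: "\<not> ?thesis"
    from ae have "AE x in lebesgue. x \<in> ?I \<longrightarrow> integrable (lebesgue_on ?I) (\<lambda>y. G x y * k y) \<and>
      \<psi> x = integral\<^sup>L (lebesgue_on ?I) (\<lambda>y. G x y * k y)"
      by (subst (asm) AE_restrict_space_iff) auto
    then have "AE x in lebesgue. x \<notin> {z - e..z + e}"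
      by eventually_elim (use no e(2) in blast)
    then have "{z - e..z + e} \<in> null_sets lebesgue"
      by (subst (asm) AE_iff_null_sets[symmetric]) auto
    then show False using e(1) by (auto simp: null_sets_def)
  qed
  then obtain x where x: "x \<in> {z - e..z + e}" "integrable (lebesgue_on ?I) (\<lambda>y. G x y * k y)"
    "\<psi> x = integral\<^sup>L (lebesgue_on ?I) (\<lambda>y. G x y * k y)" by blast
  have "((\<lambda>y. G x y * k y) has_integral \<psi> x) ?I"
    unfolding x(3) by (intro has_integral_integral_lebesgue_on x) simp
  then have "((\<lambda>y. G x y * k y) has_integral \<psi> x) {z - e..z + e}"
    by (rule has_integral_spike_set_eq[THEN iffD1, rotated 2])
      (use k(2) e(2) in \<open>force intro: empty_imp_negligible\<close>)+
  from has_integral_diff[OF this \<psi>(3)[OF x(1)]]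
  have I0: "((\<lambda>y. D x y * k y) has_integral 0) {z - e..z + e}"
    by (simp add: D_def algebra_simps)
  \<comment> \<open>The factor \<open>cnj (D z z)\<close> rotates \<open>D x y\<close> close to the
    positive real axis. Thus \<open>h\<close> is continuous and nonnegative with integral zero,
    although its lower bound at \<open>z\<close> is positive.\<close>
  define h where "h y = Re (D x y * k y * cnj (D z z))" for y
  have hI: "(h has_integral 0) {z - e..z + e}"
    using has_integral_Re[OF has_integral_mult_left[OF I0, of "cnj (D z z)"]]
    unfolding h_def by (simp only: mult_zero_left zero_complex.sel)
  have hpos: "h y \<ge> max 0 (e - \<bar>y - z\<bar>) * ((norm (D z z))\<^sup>2 / 2)" if "y \<in> {z - e..z + e}" for y
  proof -
    have "D x y * cnj (D z z) = (D x y - D z z) * cnj (D z z) + of_real ((norm (D z z))\<^sup>2)"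
      by (simp add: algebra_simps complex_norm_square[symmetric])
    then have "Re (D x y * cnj (D z z)) = Re ((D x y - D z z) * cnj (D z z)) + (norm (D z z))\<^sup>2"
      by (metis Re_complex_of_real plus_complex.sel(1))
    moreover have "\<bar>Re ((D x y - D z z) * cnj (D z z))\<bar> \<le> norm (D x y - D z z) * norm (D z z)"
      using abs_Re_le_cmod[of "(D x y - D z z) * cnj (D z z)"] by (simp add: norm_mult)
    moreover have "norm (D x y - D z z) * norm (D z z) \<le> norm (D z z) / 2 * norm (D z z)"
      using near[OF x(1) that] by (intro mult_right_mono) auto
    ultimately have "Re (D x y * cnj (D z z)) \<ge> (norm (D z z))\<^sup>2 / 2"
      by (simp add: power2_eq_square)
    moreover have "h y = max 0 (e - \<bar>y - z\<bar>) * Re (D x y * cnj (D z z))"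
      by (simp add: h_def k_def algebra_simps)
    ultimately show ?thesis
      by (simp only:) (rule mult_left_mono, simp_all)
  qed
  have "continuous_on {z - e..z + e} (\<lambda>y. D x y)"
    using continuous_on_compose2[OF cD, of "{z - e..z + e}" "\<lambda>y. (x, y)"] x(1) e(2)
    by (force intro!: continuous_intros)
  then have "continuous_on {z - e..z + e} h"
    unfolding h_def using continuous_on_subset[OF k(1), of "{z - e..z + e}"] by (auto intro!: continuous_intros)
  moreover have "0 \<le> h y" if "y \<in> {z - e..z + e}" for y
    by (rule order_trans[OF _ hpos[OF that]]) simp
  ultimately have "h z = 0"
    using integral_eq_0_iff[of "z - e" "z + e" h] integral_unique[OF hI] e(1) by auto
  moreover have "0 < e * ((norm (D z z))\<^sup>2 / 2)" using e(1) D0 by simp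
  ultimately show False using hpos[of z] e(1) by simp
qed


section \<open>Cutoff functions and the resolvent\<close>

text \<open>A piecewise quadratic step from 0 to 1 on the unit interval, whose derivative is the
  tent of height 2. One continuous derivative is enough because the estimates for the first order
  system never differentiate a cutoff twice.\<close>

definition smoothstep :: "real \<Rightarrow> real" where
  "smoothstep x = 2 * (max 0 x)\<^sup>2 - 4 * (max 0 (x - 1/2))\<^sup>2 + 2 * (max 0 (x - 1))\<^sup>2"

definition smoothstep' :: "real \<Rightarrow> real" where
  "smoothstep' x = 4 * max 0 x - 8 * max 0 (x - 1/2) + 4 * max 0 (x - 1)"

lemma has_real_derivative_max_square:
  "((\<lambda>x::real. (max 0 x)\<^sup>2) has_real_derivative 2 * max 0 x) (at x)"
proof (cases "x = 0")
  case True
  have "((\<lambda>h. (max 0 h)\<^sup>2 / h) \<longlongrightarrow> (0::real)) (at 0)"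
  proof (rule Lim_null_comparison)
    show "eventually (\<lambda>h. norm ((max 0 h)\<^sup>2 / h) \<le> \<bar>h\<bar>) (at (0::real))"
      by (intro always_eventually allI) (auto simp: max_def power2_eq_square)
    show "((\<lambda>h::real. \<bar>h\<bar>) \<longlongrightarrow> 0) (at 0)"
      using tendsto_rabs_zero[OF tendsto_ident_at[of "0::real" UNIV]] by simp
  qed
  then show ?thesis by (simp add: True has_field_derivative_def DERIV_def flip: has_field_derivative_def)
next
  case False
  show ?thesis
  proof (cases "x > 0")
    case True
    have "((\<lambda>x. x\<^sup>2) has_real_derivative 2 * max 0 x) (at x)"
      using True by (auto intro!: derivative_eq_intros)
    then show ?thesis
      by (rule has_field_derivative_transform_within_open[of _ _ _ "{0<..}"]) (use True in auto)
  next
    case F: False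
    have "((\<lambda>x. 0) has_real_derivative 2 * max 0 x) (at x)"
      using F by (auto intro!: derivative_eq_intros)
    then show ?thesis
      by (rule has_field_derivative_transform_within_open[of _ _ _ "{..<0}"]) (use F False in auto)
  qed
qed

lemma smoothstep_deriv: "(smoothstep has_real_derivative smoothstep' x) (at x)"
proof -
  have 1: "((\<lambda>x. (max 0 (x - c))\<^sup>2) has_real_derivative 2 * max 0 (x - c)) (at x)" for c :: real
    using DERIV_shift[of "\<lambda>x. (max 0 x)\<^sup>2" "2 * max 0 (x - c)" x "- c"]
      has_real_derivative_max_square[of "x - c"] by simp
  show ?thesis
    unfolding smoothstep_def[abs_def] smoothstep'_def
    by (rule derivative_eq_intros has_real_derivative_max_square 1 refl)+ simp
qed

lemma smoothstep_bounds:
  "0 \<le> smoothstep' x" "smoothstep' x \<le> 2" "x \<notin> {0<..<1} \<Longrightarrow> smoothstep' x = 0"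
  "x \<le> 0 \<Longrightarrow> smoothstep x = 0" "1 \<le> x \<Longrightarrow> smoothstep x = 1"
  by (auto simp: smoothstep_def smoothstep'_def max_def power2_eq_square field_simps)

lemma smoothstep_range: "0 \<le> smoothstep x" "smoothstep x \<le> 1"
proof -
  have mono: "smoothstep y \<le> smoothstep z" if "y \<le> z" for y z
    by (rule DERIV_nonneg_imp_nondecreasing[OF that]) (use smoothstep_deriv smoothstep_bounds(1) in blast)
  show "0 \<le> smoothstep x"
    using mono[of "min 0 x" x] smoothstep_bounds(4)[of "min 0 x"] by simp
  show "smoothstep x \<le> 1"
    using mono[of x "max 1 x"] smoothstep_bounds(5)[of "max 1 x"] by simp
qed

text \<open>A rising and a falling step are added and 1 is subtracted. Since
  \<open>s \<le> t\<close>, at every point at least one of the two steps equals 1. The slope bound 2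
  does not depend on the length of the plateau.\<close>

lemma cutoff_exists:
  fixes s t :: real
  assumes "s \<le> t"
  obtains \<rho> \<rho>' :: "real \<Rightarrow> real" where
    "\<And>x. (\<rho> has_real_derivative \<rho>' x) (at x)" "continuous_on UNIV \<rho>'"
    "\<And>x. 0 \<le> \<rho> x" "\<And>x. \<rho> x \<le> 1" "\<And>x. x \<in> {s..t} \<Longrightarrow> \<rho> x = 1"
    "\<And>x. x \<notin> {s - 1<..<t + 1} \<Longrightarrow> \<rho> x = 0" "\<And>x. \<bar>\<rho>' x\<bar> \<le> 2"
    "\<And>x. x \<notin> {s - 1..s} \<union> {t..t + 1} \<Longrightarrow> \<rho>' x = 0"
proof
  let ?\<rho> = "\<lambda>x. smoothstep (x - s + 1) + smoothstep (t + 1 - x) - 1"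
  let ?\<rho>' = "\<lambda>x. smoothstep' (x - s + 1) - smoothstep' (t + 1 - x)"
  show "(?\<rho> has_real_derivative ?\<rho>' x) (at x)" for x
    by (rule derivative_eq_intros DERIV_chain2[OF smoothstep_deriv] refl)+ simp
  show "continuous_on UNIV ?\<rho>'"
    unfolding smoothstep'_def by (intro continuous_intros)
  have c: "1 \<le> x - s + 1 \<or> 1 \<le> t + 1 - x" for x
    using assms by linarith
  show "0 \<le> ?\<rho> x" for x
    using c[of x] smoothstep_bounds(5)[of "x - s + 1"] smoothstep_bounds(5)[of "t + 1 - x"]
      smoothstep_range[of "x - s + 1"] smoothstep_range[of "t + 1 - x"] by auto
  show "?\<rho> x \<le> 1" for x
    using smoothstep_range(2)[of "x - s + 1"] smoothstep_range(2)[of "t + 1 - x"] by linarith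
  show "?\<rho> x = 1" if "x \<in> {s..t}" for x
    using that by (simp add: smoothstep_bounds)
  show "?\<rho> x = 0" if "x \<notin> {s - 1<..<t + 1}" for x
    using that assms by (auto simp: smoothstep_bounds not_less)
  show "\<bar>?\<rho>' x\<bar> \<le> 2" for x
    using smoothstep_bounds(1,2)[of "x - s + 1"] smoothstep_bounds(1,2)[of "t + 1 - x"] by linarith
  show "?\<rho>' x = 0" if "x \<notin> {s - 1..s} \<union> {t..t + 1}" for x
    using that by (auto simp: smoothstep_bounds)
qed

lemma L2_square_integrable:
  assumes "f \<in> L2 I" "I \<in> sets lebesgue" "{p..q} \<subseteq> I"
  shows "(\<lambda>x. (norm (f x))\<^sup>2) integrable_on {p..q}"
    and "integral {p..q} (\<lambda>x. (norm (f x))\<^sup>2) \<le> (L2_norm I f)\<^sup>2"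
proof -
  have 1: "(\<lambda>x. (norm (f x))\<^sup>2) absolutely_integrable_on I"
    using assms by (simp add: L2_iff)
  then have 2: "(\<lambda>x. (norm (f x))\<^sup>2) integrable_on I"
    by (rule set_lebesgue_integral_eq_integral(1))
  show 3: "(\<lambda>x. (norm (f x))\<^sup>2) integrable_on {p..q}"
    by (rule set_lebesgue_integral_eq_integral(1)[OF absolutely_integrable_on_subinterval[OF 1 assms(3)]])
  show "integral {p..q} (\<lambda>x. (norm (f x))\<^sup>2) \<le> (L2_norm I f)\<^sup>2"
    unfolding L2_norm_square[OF assms(1,2)]
    by (rule integral_subset_le) (use assms 2 3 in auto)
qed

section \<open>The resolvent on the classical domain\<close>

text \<open>The bounded inverse is restricted to classical functions; squaring the bound fits the
  later estimates and makes the constant nonnegative.\<close>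

lemma resolvent_set_hamiltonianD:
  assumes "E \<notin> spec a b V"
  obtains C where "\<And>\<eta> \<phi>. (\<eta>, \<phi>) \<in> hamiltonian0 a b V \<Longrightarrow>
      (L2_norm (einterval a b) \<eta>)\<^sup>2 \<le> C * (L2_norm (einterval a b) (\<lambda>x. \<phi> x - E * \<eta> x))\<^sup>2" "0 \<le> C"
proof -
  let ?I = "einterval a b"
  from assms obtain C where C: "\<And>\<psi> \<phi>. (\<psi>, \<phi>) \<in> hamiltonian a b V \<Longrightarrow>
      L2_norm ?I \<psi> \<le> C * L2_norm ?I (\<lambda>x. \<phi> x - E * \<psi> x)"
    unfolding spec_def resolvent_set_def by fast
  have "(L2_norm ?I \<eta>)\<^sup>2 \<le> C\<^sup>2 * (L2_norm ?I (\<lambda>x. \<phi> x - E * \<eta> x))\<^sup>2"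
    if "(\<eta>, \<phi>) \<in> hamiltonian0 a b V" for \<eta> \<phi>
  proof -
    have "(\<eta>, \<phi>) \<in> hamiltonian a b V"
      using that hamiltonian0_subset by blast
    from power_mono[OF C[OF this], of 2] show ?thesis
      by (simp add: power_mult_distrib L2_norm_def)
  qed
  from that[OF this] show thesis by simp
qed

text \<open>The preimage of \<open>k\<close> provided by the resolvent lies only in the closure of
  the operator. Approximating it in the graph norm gives classical functions, which can be
  differentiated, at the price of an arbitrarily small error.\<close>

lemma resolvent_set_dense_range:
  assumes "E \<notin> spec a b V" "k \<in> L2 (einterval a b)" "\<delta> > 0"
  obtains \<eta> \<phi> where "(\<eta>, \<phi>) \<in> hamiltonian0 a b V"
    "(L2_norm (einterval a b) (\<lambda>x. \<phi> x - E * \<eta> x - k x))\<^sup>2 < \<delta>"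
proof -
  let ?I = "einterval a b"
  from assms(1,2) obtain \<psi> where "(\<psi>, \<lambda>x. k x + E * \<psi> x) \<in> hamiltonian a b V"
    unfolding spec_def resolvent_set_def by blast
  then obtain \<Psi> \<Phi> where L: "\<psi> \<in> L2 ?I" "(\<lambda>x. k x + E * \<psi> x) \<in> L2 ?I"
    "\<And>n. (\<Psi> n, \<Phi> n) \<in> hamiltonian0 a b V"
    "L2_lim ?I \<Psi> \<psi>" "L2_lim ?I \<Phi> (\<lambda>x. k x + E * \<psi> x)"
    unfolding hamiltonian_def graph_closure_def by blast
  define A where "A n = (\<lambda>x. \<Psi> n x - \<psi> x)" for n
  define B where "B n = (\<lambda>x. \<Phi> n x - (k x + E * \<psi> x))" for n
  have in0: "\<Psi> n \<in> L2 ?I" "\<Phi> n \<in> L2 ?I" for n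
    using L(3)[of n] by (auto simp: hamiltonian0_def)
  have AB: "A n \<in> L2 ?I" "B n \<in> L2 ?I" for n
    using L2_linear(1)[OF in0(1) L(1), where p = 1 and q = "-1"] L2_linear(1)[OF in0(2) L(2), where p = 1 and q = "-1"]
    by (simp_all add: A_def B_def algebra_simps)
  have "(\<lambda>n. 2 * (L2_norm ?I (B n))\<^sup>2 + 2 * (norm E)\<^sup>2 * (L2_norm ?I (A n))\<^sup>2) \<longlonglongrightarrow>
     2 * 0\<^sup>2 + 2 * (norm E)\<^sup>2 * 0\<^sup>2"
    using L(4,5) unfolding L2_lim_def A_def B_def by (intro tendsto_intros)
  then have "eventually (\<lambda>n. 2 * (L2_norm ?I (B n))\<^sup>2 + 2 * (norm E)\<^sup>2 * (L2_norm ?I (A n))\<^sup>2 < \<delta>) sequentially"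
    by (rule order_tendstoD(2)) (use assms(3) in simp)
  then obtain n where n: "2 * (L2_norm ?I (B n))\<^sup>2 + 2 * (norm E)\<^sup>2 * (L2_norm ?I (A n))\<^sup>2 < \<delta>"
    by (auto simp: eventually_sequentially)
  have "(L2_norm ?I (\<lambda>x. 1 * B n x + (- E) * A n x))\<^sup>2 < \<delta>"
    using L2_linear(2)[OF AB(2)[of n] AB(1)[of n], of 1 "- E"] n by simp
  moreover have "(\<lambda>x. 1 * B n x + (- E) * A n x) = (\<lambda>x. \<Phi> n x - E * \<Psi> n x - k x)"
    by (auto simp: A_def B_def algebra_simps)
  ultimately show thesis
    using that[OF L(3)[of n]] by simp
qed

lemma young_inequality:
  fixes x y \<epsilon> :: real
  assumes "\<epsilon> > 0" shows "x * y \<le> \<epsilon> * x\<^sup>2 + y\<^sup>2 / (4 * \<epsilon>)"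
proof -
  have "0 \<le> (2 * \<epsilon> * x - y)\<^sup>2 / (4 * \<epsilon>)" using assms by simp
  also have "\<dots> = \<epsilon> * x\<^sup>2 + y\<^sup>2 / (4 * \<epsilon>) - x * y"
    using assms by (simp add: field_simps power2_eq_square)
  finally show ?thesis by simp
qed

text \<open>Moving the inner end changes the domain by a compact piece only, on which
  \<open>h\<close> is continuous.\<close>

lemma absolutely_integrable_einterval_extend:
  fixes h :: "real \<Rightarrow> real"
  assumes "continuous_on (einterval a b) h" "c \<in> einterval a b" "d \<in> einterval a b"
  shows "h absolutely_integrable_on einterval a d \<Longrightarrow> h absolutely_integrable_on einterval a c"
    and "h absolutely_integrable_on einterval d b \<Longrightarrow> h absolutely_integrable_on einterval c b"
proof -
  have sub: "{min c d..max c d} \<subseteq> einterval a b"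
    using assms(2,3) by (intro einterval_Icc_subset) (auto simp: einterval_iff min_def max_def)
  have mid: "h absolutely_integrable_on {min c d..max c d}"
    by (intro absolutely_integrable_continuous_real continuous_on_subset[OF assms(1) sub])
  show "h absolutely_integrable_on einterval a c" if "h absolutely_integrable_on einterval a d"
  proof (rule set_integrable_subset[OF set_integrable_Un[OF that mid]])
    show "einterval a c \<subseteq> einterval a d \<union> {min c d..max c d}"
      by (auto simp: einterval_iff)
  qed auto
  show "h absolutely_integrable_on einterval c b" if "h absolutely_integrable_on einterval d b"
  proof (rule set_integrable_subset[OF set_integrable_Un[OF that mid]])
    show "einterval c b \<subseteq> einterval d b \<union> {min c d..max c d}"
      by (auto simp: einterval_iff)
  qed auto
qed


section \<open>The first order system of a SUSY transformation\<close>

text \<open>The two Riccati equations express the factorizations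
  \<open>L^+ L = h0 - \<alpha>\<close> and \<open>L L^+ = h1 - \<alpha>\<close>; nothing else is
  retained of the function \<open>u\<close>.\<close>

locale superpotential_pair =
  fixes a b :: ereal and V0 V1 w w' :: "real \<Rightarrow> real" and \<alpha> :: real
  assumes ab: "a < b"
    and w_deriv: "\<And>x. x \<in> einterval a b \<Longrightarrow> (w has_vector_derivative w' x) (at x)"
    and V0_eq: "\<And>x. x \<in> einterval a b \<Longrightarrow> V0 x = \<alpha> + (w x)\<^sup>2 + w' x"
    and V1_eq: "\<And>x. x \<in> einterval a b \<Longrightarrow> V1 x = \<alpha> + (w x)\<^sup>2 - w' x"
begin

abbreviation I :: "real set" where "I \<equiv> einterval a b"

text \<open>The equation \<open>(h\<^sub>0 - E) f = F\<close> as a first order system for \<open>f\<close> and \<open>g = L f\<close>. It involves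
  neither the potential nor the derivative of \<open>w\<close>.\<close>

definition first_order_system ::
    "complex \<Rightarrow> (real \<Rightarrow> complex) \<Rightarrow> (real \<Rightarrow> complex) \<Rightarrow> (real \<Rightarrow> complex) \<Rightarrow> bool" where
  "first_order_system E F f g \<longleftrightarrow> (\<forall>x\<in>I.
     (f has_vector_derivative of_real (w x) * f x - g x) (at x) \<and>
     (g has_vector_derivative F x - of_real (w x) * g x + (E - \<alpha>) * f x) (at x))"

abbreviation solution :: "complex \<Rightarrow> (real \<Rightarrow> complex) \<Rightarrow> (real \<Rightarrow> complex) \<Rightarrow> bool" where
  "solution E \<equiv> first_order_system E (\<lambda>_. 0)"

lemma first_order_systemD:
  assumes "first_order_system E F f g" "x \<in> I"
  shows "(f has_vector_derivative of_real (w x) * f x - g x) (at x)"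
    "(g has_vector_derivative F x - of_real (w x) * g x + (E - \<alpha>) * f x) (at x)"
  using assms by (auto simp: first_order_system_def)

lemma first_order_system_continuous:
  assumes "first_order_system E F f g"
  shows "continuous_on I f" "continuous_on I g"
  by (rule continuous_on_vector_derivative, erule first_order_systemD[OF assms])+

text \<open>The \<open>w'\<close> that arises from differentiating \<open>w f\<close> cancels
  against the \<open>w'\<close> contained in \<open>V0\<close>.\<close>

lemma first_order_systemI:
  assumes d1: "\<And>x. x \<in> I \<Longrightarrow> (f has_vector_derivative f1 x) (at x)"
    and d2: "\<And>x. x \<in> I \<Longrightarrow> (f1 has_vector_derivative V0 x *\<^sub>R f x - E * f x - F x) (at x)"
  shows "first_order_system E F f (\<lambda>x. - f1 x + of_real (w x) * f x)"
  unfolding first_order_system_def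
proof (intro ballI conjI)
  fix x assume x: "x \<in> I"
  show "(f has_vector_derivative of_real (w x) * f x - (- f1 x + of_real (w x) * f x)) (at x)"
    using d1[OF x] by simp
  have w: "((\<lambda>x. of_real (w x) :: complex) has_vector_derivative of_real (w' x)) (at x)"
    by (rule has_vector_derivative_of_real[OF w_deriv[OF x, unfolded has_real_derivative_iff_has_vector_derivative[symmetric]]])
  show "((\<lambda>x. - f1 x + of_real (w x) * f x) has_vector_derivative
      F x - of_real (w x) * (- f1 x + of_real (w x) * f x) + (E - \<alpha>) * f x) (at x)"
    by (rule derivative_eq_intros d1[OF x] d2[OF x] w refl)+
      (simp add: V0_eq[OF x] algebra_simps power2_eq_square scaleR_conv_of_real)
qed

text \<open>When the second equation is differentiated and the first inserted, \<open>f\<close>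
  drops out and an equation for \<open>g\<close> alone remains; the sign of \<open>w'\<close> is now
  that of \<open>V1\<close>.\<close>

lemma solution_partner_solves:
  assumes "solution E f g" shows "solves I V1 E g"
proof (rule solvesI)
  note D = first_order_systemD[OF assms]
  show "open I" by simp
  fix x assume x: "x \<in> I"
  show "(g has_vector_derivative (E - \<alpha>) * f x - of_real (w x) * g x) (at x)"
    using D(2)[OF x] by (simp add: algebra_simps)
  have w: "((\<lambda>x. of_real (w x) :: complex) has_vector_derivative of_real (w' x)) (at x)"
    by (rule has_vector_derivative_of_real[OF w_deriv[OF x, unfolded has_real_derivative_iff_has_vector_derivative[symmetric]]])
  show "((\<lambda>x. (E - \<alpha>) * f x - of_real (w x) * g x) has_vector_derivative V1 x *\<^sub>R g x - E * g x) (at x)"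
    by (rule derivative_eq_intros D[OF x] w refl)+
      (simp add: V1_eq[OF x] algebra_simps power2_eq_square scaleR_conv_of_real)
qed

section \<open>Weighted integral estimates\<close>

text \<open>Differentiating \<open>\<rho>^2 cnj \<eta> H\<close> produces
  \<open>- \<rho>^2 |H|^2\<close>, and the boundary terms vanish with \<open>\<rho>\<close>. The
  cross term with \<open>\<rho>'\<close> is absorbed by the quadratic term. As the terms with
  \<open>w\<close> cancel, the constant depends on \<open>E - \<alpha>\<close> only.\<close>

lemma caccioppoli:
  fixes \<rho> \<rho>' :: "real \<Rightarrow> real"
  assumes sys: "first_order_system E F \<eta> H" and pq: "p \<le> q" "{p..q} \<subseteq> I"
    and \<rho>: "\<And>x. (\<rho> has_real_derivative \<rho>' x) (at x)" "\<And>x. 0 \<le> \<rho> x" "\<And>x. \<rho> x \<le> 1"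
      "\<And>x. \<bar>\<rho>' x\<bar> \<le> 2" "\<rho> p = 0" "\<rho> q = 0"
    and F: "(\<lambda>x. (norm (F x))\<^sup>2) integrable_on {p..q}"
  shows "integral {p..q} (\<lambda>x. (\<rho> x)\<^sup>2 * (norm (H x))\<^sup>2) \<le>
    2 * (9 + norm (E - \<alpha>)) * (integral {p..q} (\<lambda>x. (norm (\<eta> x))\<^sup>2) + integral {p..q} (\<lambda>x. (norm (F x))\<^sup>2))"
proof -
  note D = first_order_systemD[OF sys]
  define \<kappa> where "\<kappa> = E - \<alpha>"
  define G where "G x = 2 * \<rho> x * \<rho>' x * (cnj (\<eta> x) * H x) - (\<rho> x)\<^sup>2 * (norm (H x))\<^sup>2
      + (\<rho> x)\<^sup>2 * cnj (\<eta> x) * (F x + \<kappa> * \<eta> x)" for x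
  have dG: "((\<lambda>x. (of_real (\<rho> x))\<^sup>2 * (cnj (\<eta> x) * H x)) has_vector_derivative G x) (at x)" if "x \<in> I" for x
  proof -
    have r: "((\<lambda>x. of_real (\<rho> x) :: complex) has_vector_derivative of_real (\<rho>' x)) (at x)"
      by (rule has_vector_derivative_of_real[OF \<rho>(1)])
    have c: "((\<lambda>x. cnj (\<eta> x)) has_vector_derivative cnj (of_real (w x) * \<eta> x - H x)) (at x)"
      by (rule has_vector_derivative_cnj[OF D(1)[OF that]])
    have "of_real (\<rho> x) * of_real (\<rho> x) * (cnj (\<eta> x) * (F x - of_real (w x) * H x + (E - \<alpha>) * \<eta> x)
          + cnj (of_real (w x) * \<eta> x - H x) * H x)
        + (of_real (\<rho> x) * of_real (\<rho>' x) + of_real (\<rho>' x) * of_real (\<rho> x)) * (cnj (\<eta> x) * H x) = G x"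
      unfolding G_def \<kappa>_def of_real_mult complex_norm_square
      by (simp add: algebra_simps power2_eq_square)
    with has_vector_derivative_mult[OF has_vector_derivative_mult[OF r r]
        has_vector_derivative_mult[OF c D(2)[OF that]]]
    show ?thesis unfolding power2_eq_square by simp
  qed
  have "(G has_integral ((of_real (\<rho> q))\<^sup>2 * (cnj (\<eta> q) * H q) - (of_real (\<rho> p))\<^sup>2 * (cnj (\<eta> p) * H p))) {p..q}"
    by (rule fundamental_theorem_of_calculus[OF pq(1) has_vector_derivative_at_within[OF dG[OF subsetD[OF pq(2)]]]])
  then have G0: "((\<lambda>x. Re (G x)) has_integral 0) {p..q}"
    using has_integral_Re[of G 0] \<rho>(5,6) by simp
  have c: "continuous_on {p..q} \<eta>" "continuous_on {p..q} H" "continuous_on {p..q} \<rho>"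
    using first_order_system_continuous[OF sys] pq(2)
      DERIV_continuous_on[of "{p..q}" \<rho> \<rho>'] has_field_derivative_at_within[OF \<rho>(1)]
    by (auto intro: continuous_on_subset)
  have int: "(\<lambda>x. (norm (\<eta> x))\<^sup>2) integrable_on {p..q}" "(\<lambda>x. (\<rho> x)\<^sup>2 * (norm (H x))\<^sup>2) integrable_on {p..q}"
    by (intro integrable_continuous_real continuous_intros c)+
  have pt: "(\<rho> x)\<^sup>2 * (norm (H x))\<^sup>2 \<le> - 2 * Re (G x)
      + 2 * (9 + norm \<kappa>) * ((norm (\<eta> x))\<^sup>2 + (norm (F x))\<^sup>2)" for x
  proof -
    define r h e f where "r = \<rho> x" "h = norm (H x)" "e = norm (\<eta> x)" "f = norm (F x)"
    have nn: "0 \<le> h" "0 \<le> e" "0 \<le> f" "0 \<le> r" "r \<le> 1" "\<bar>\<rho>' x\<bar> \<le> 2"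
      using \<rho> by (auto simp: r_h_e_f_def)
    have r2: "r\<^sup>2 \<le> 1" using nn by (simp add: power_le_one)
    have A: "\<bar>Re (2 * \<rho> x * \<rho>' x * (cnj (\<eta> x) * H x))\<bar> \<le> 4 * (e * (r * h))"
    proof -
      have "\<bar>Re (2 * \<rho> x * \<rho>' x * (cnj (\<eta> x) * H x))\<bar> \<le> norm (2 * \<rho> x * \<rho>' x * (cnj (\<eta> x) * H x))"
        by (rule abs_Re_le_cmod)
      also have "\<dots> = 2 * \<bar>\<rho>' x\<bar> * (e * (r * h))"
        using nn by (simp add: r_h_e_f_def norm_mult)
      also have "\<dots> \<le> 2 * 2 * (e * (r * h))"
        using nn by (intro mult_right_mono) auto
      finally show ?thesis by simp
    qed
    have B: "\<bar>Re ((\<rho> x)\<^sup>2 * cnj (\<eta> x) * (F x + \<kappa> * \<eta> x))\<bar> \<le> e * f + norm \<kappa> * e\<^sup>2"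
    proof -
      have "\<bar>Re ((\<rho> x)\<^sup>2 * cnj (\<eta> x) * (F x + \<kappa> * \<eta> x))\<bar> \<le> norm ((\<rho> x)\<^sup>2 * cnj (\<eta> x) * (F x + \<kappa> * \<eta> x))"
        by (rule abs_Re_le_cmod)
      also have "\<dots> = r\<^sup>2 * (e * norm (F x + \<kappa> * \<eta> x))"
        by (simp add: r_h_e_f_def norm_mult norm_power)
      also have "\<dots> \<le> 1 * (e * (f + norm \<kappa> * e))"
        using r2 nn norm_triangle_ineq[of "F x" "\<kappa> * \<eta> x"]
        by (intro mult_mono) (auto simp: r_h_e_f_def norm_mult)
      finally show ?thesis by (simp add: algebra_simps power2_eq_square)
    qed
    have "Re (G x) = Re (2 * \<rho> x * \<rho>' x * (cnj (\<eta> x) * H x)) - r\<^sup>2 * h\<^sup>2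
        + Re ((\<rho> x)\<^sup>2 * cnj (\<eta> x) * (F x + \<kappa> * \<eta> x))"
      unfolding G_def r_h_e_f_def by (simp flip: of_real_power of_real_mult)
    with A B have "r\<^sup>2 * h\<^sup>2 \<le> - Re (G x) + 4 * (e * (r * h)) + e * f + norm \<kappa> * e\<^sup>2"
      by linarith
    \<comment> \<open>Once the preceding bound is doubled, this absorbs one of the two copies of
      \<open>(r * h)^2\<close>. The coefficient of \<open>e^2\<close> becomes \<open>16 + 1\<close>,
      rounded up to the \<open>2 * 9\<close> of the claim.\<close>
    moreover have "8 * (e * (r * h)) \<le> (r * h)\<^sup>2 + 16 * e\<^sup>2"
      using zero_le_power2[of "r * h - 4 * e"] by (simp add: power2_eq_square algebra_simps)
    moreover have "2 * (e * f) \<le> e\<^sup>2 + f\<^sup>2"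
      using sum_squares_bound[of e f] by simp
    ultimately have "r\<^sup>2 * h\<^sup>2 \<le> - 2 * Re (G x) + 17 * e\<^sup>2 + f\<^sup>2 + 2 * norm \<kappa> * e\<^sup>2"
      by (simp add: power_mult_distrib)
    also have "\<dots> \<le> - 2 * Re (G x) + 2 * (9 + norm \<kappa>) * (e\<^sup>2 + f\<^sup>2)"
      by (simp add: algebra_simps)
    finally show ?thesis by (simp add: r_h_e_f_def)
  qed
  have "((\<lambda>x. - 2 * Re (G x) + 2 * (9 + norm \<kappa>) * ((norm (\<eta> x))\<^sup>2 + (norm (F x))\<^sup>2)) has_integral
     (- 2 * 0 + 2 * (9 + norm \<kappa>) * (integral {p..q} (\<lambda>x. (norm (\<eta> x))\<^sup>2) + integral {p..q} (\<lambda>x. (norm (F x))\<^sup>2)))) {p..q}"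
    by (intro has_integral_add has_integral_mult_right G0 integrable_integral int F)
  from has_integral_le[OF integrable_integral[OF int(2)] this] pt
  show ?thesis by (simp add: \<kappa>_def)
qed

text \<open>The identity \<open>(H f - \<eta> g)' = F f\<close> is integrated against
  \<open>\<rho>\<close>, which moves the derivative onto \<open>\<rho>\<close>. When
  \<open>F\<close> is near \<open>\<rho> cnj f\<close>, the left side is nearly the integral of
  \<open>\<rho>^2 |f|^2\<close>. The weight \<open>\<epsilon>\<close> makes the terms in
  \<open>H\<close> and \<open>\<eta>\<close> small enough to be absorbed later, leaving
  \<open>f\<close> and \<open>g\<close> only where \<open>\<rho>'\<close> is nonzero.\<close>

lemma duality_estimate:
  fixes \<rho> \<rho>' \<tau> :: "real \<Rightarrow> real"
  assumes sol: "solution E f g" and sys: "first_order_system E F \<eta> H"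
    and pq: "p \<le> q" "{p..q} \<subseteq> I"
    and \<rho>: "\<And>x. (\<rho> has_real_derivative \<rho>' x) (at x)" "continuous_on UNIV \<rho>'" "\<rho> p = 0" "\<rho> q = 0"
    and \<tau>: "continuous_on UNIV \<tau>" "\<And>x. \<rho>' x \<noteq> 0 \<Longrightarrow> \<tau> x = 1"
    and F: "(\<lambda>x. (norm (F x - \<rho> x * cnj (f x)))\<^sup>2) integrable_on {p..q}" and "\<epsilon> > 0"
  shows "1/2 * integral {p..q} (\<lambda>x. (\<rho> x)\<^sup>2 * (norm (f x))\<^sup>2) \<le>
    1/2 * integral {p..q} (\<lambda>x. (norm (F x - \<rho> x * cnj (f x)))\<^sup>2)
    + \<epsilon> * (integral {p..q} (\<lambda>x. (\<tau> x)\<^sup>2 * (norm (H x))\<^sup>2) + integral {p..q} (\<lambda>x. (norm (\<eta> x))\<^sup>2))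
    + 1 / (4 * \<epsilon>) * integral {p..q} (\<lambda>x. (\<rho>' x)\<^sup>2 * ((norm (f x))\<^sup>2 + (norm (g x))\<^sup>2))"
proof -
  define D where "D x = \<rho> x * (F x * f x) + \<rho>' x * (H x * f x - \<eta> x * g x)" for x
  have dD: "((\<lambda>x. of_real (\<rho> x) * (H x * f x - \<eta> x * g x)) has_vector_derivative D x) (at x)" if "x \<in> I" for x
  proof -
    note d = first_order_systemD[OF sys that] first_order_systemD[OF sol that]
    have r: "((\<lambda>x. of_real (\<rho> x) :: complex) has_vector_derivative of_real (\<rho>' x)) (at x)"
      by (rule has_vector_derivative_of_real[OF \<rho>(1)])
    show ?thesis
      using has_vector_derivative_mult[OF r has_vector_derivative_diff[OF
          has_vector_derivative_mult[OF d(2,3)] has_vector_derivative_mult[OF d(1,4)]]]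
      by (rule back_subst) (simp add: D_def algebra_simps)
  qed
  have "(D has_integral (of_real (\<rho> q) * (H q * f q - \<eta> q * g q) - of_real (\<rho> p) * (H p * f p - \<eta> p * g p))) {p..q}"
    by (rule fundamental_theorem_of_calculus[OF pq(1) has_vector_derivative_at_within[OF dD[OF subsetD[OF pq(2)]]]])
  then have D0: "((\<lambda>x. Re (D x)) has_integral 0) {p..q}"
    using has_integral_Re[of D 0] \<rho>(3,4) by simp
  have c: "continuous_on {p..q} \<eta>" "continuous_on {p..q} H" "continuous_on {p..q} f"
    "continuous_on {p..q} g" "continuous_on {p..q} \<rho>" "continuous_on {p..q} \<rho>'" "continuous_on {p..q} \<tau>"
    using first_order_system_continuous[OF sys] first_order_system_continuous[OF sol] pq(2) \<rho>(2) \<tau>(1)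
      DERIV_continuous_on[of "{p..q}" \<rho> \<rho>'] has_field_derivative_at_within[OF \<rho>(1)]
    by (auto intro: continuous_on_subset)
  have int: "(\<lambda>x. (norm (\<eta> x))\<^sup>2) integrable_on {p..q}" "(\<lambda>x. (\<rho> x)\<^sup>2 * (norm (f x))\<^sup>2) integrable_on {p..q}"
    "(\<lambda>x. (\<tau> x)\<^sup>2 * (norm (H x))\<^sup>2) integrable_on {p..q}"
    "(\<lambda>x. (\<rho>' x)\<^sup>2 * ((norm (f x))\<^sup>2 + (norm (g x))\<^sup>2)) integrable_on {p..q}"
    by (intro integrable_continuous_real continuous_intros c)+
  have pt: "1/2 * ((\<rho> x)\<^sup>2 * (norm (f x))\<^sup>2) \<le> Re (D x) + 1/2 * (norm (F x - \<rho> x * cnj (f x)))\<^sup>2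
      + \<epsilon> * ((\<tau> x)\<^sup>2 * (norm (H x))\<^sup>2 + (norm (\<eta> x))\<^sup>2)
      + 1 / (4 * \<epsilon>) * ((\<rho>' x)\<^sup>2 * ((norm (f x))\<^sup>2 + (norm (g x))\<^sup>2))" for x
  proof -
    define r where "r = \<bar>\<rho> x\<bar> * norm (f x)"
    define d where "d = norm (F x - \<rho> x * cnj (f x))"
    have r2: "r\<^sup>2 = (\<rho> x)\<^sup>2 * (norm (f x))\<^sup>2" by (simp add: r_def power_mult_distrib)
    \<comment> \<open>The deviation of \<open>\<rho> F f\<close> from \<open>r^2\<close> has norm
      \<open>r * d\<close>; bounding this by half the sum of squares leaves the factor 1/2 in front
      of \<open>r^2\<close>.\<close>
    have "of_real (r\<^sup>2) - \<rho> x * (F x * f x) = - (\<rho> x * f x * (F x - \<rho> x * cnj (f x)))"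
      unfolding r2 of_real_mult complex_norm_square by (simp add: algebra_simps power2_eq_square)
    then have "norm (of_real (r\<^sup>2) - \<rho> x * (F x * f x)) = r * d"
      by (simp only: norm_minus_cancel norm_mult r_def d_def norm_of_real)
    then have "r\<^sup>2 - Re (\<rho> x * (F x * f x)) \<le> r * d"
      using complex_Re_le_cmod[of "of_real (r\<^sup>2) - \<rho> x * (F x * f x)"]
      by (simp only: minus_complex.sel Re_complex_of_real)
    moreover have "2 * (r * d) \<le> r\<^sup>2 + d\<^sup>2"
      using sum_squares_bound[of r d] by simp
    ultimately have 1: "1/2 * r\<^sup>2 \<le> Re (\<rho> x * (F x * f x)) + 1/2 * d\<^sup>2"
      by linarith
    have ReD: "Re (\<rho> x * (F x * f x)) = Re (D x) - Re (\<rho>' x * (H x * f x - \<eta> x * g x))"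
      by (simp add: D_def)
    have "- Re (\<rho>' x * (H x * f x - \<eta> x * g x)) \<le> norm (\<rho>' x * (H x * f x - \<eta> x * g x))"
      using abs_Re_le_cmod[of "\<rho>' x * (H x * f x - \<eta> x * g x)"] by linarith
    also have "\<dots> \<le> \<bar>\<rho>' x\<bar> * (norm (H x) * norm (f x) + norm (\<eta> x) * norm (g x))"
      unfolding norm_mult norm_of_real
      using norm_triangle_ineq4[of "H x * f x" "\<eta> x * g x"] by (intro mult_left_mono) (auto simp: norm_mult)
    also have "\<dots> = (norm (H x) * (\<bar>\<rho>' x\<bar> * norm (f x))) + (norm (\<eta> x) * (\<bar>\<rho>' x\<bar> * norm (g x)))"
      by (simp add: algebra_simps)
    finally have 2: "Re (\<rho> x * (F x * f x)) \<le> Re (D x) +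
      ((norm (H x) * (\<bar>\<rho>' x\<bar> * norm (f x))) + (norm (\<eta> x) * (\<bar>\<rho>' x\<bar> * norm (g x))))"
      using ReD by linarith
    \<comment> \<open>Where \<open>\<rho>'\<close> vanishes the left side is zero; elsewhere
      \<open>\<tau>\<close> is 1, so inserting the weight costs nothing.\<close>
    have 3: "norm (H x) * (\<bar>\<rho>' x\<bar> * norm (f x)) \<le> \<epsilon> * ((\<tau> x)\<^sup>2 * (norm (H x))\<^sup>2)
        + (\<bar>\<rho>' x\<bar> * norm (f x))\<^sup>2 / (4 * \<epsilon>)"
      using young_inequality[OF \<open>\<epsilon> > 0\<close>, of "norm (H x)" "\<bar>\<rho>' x\<bar> * norm (f x)"] \<tau>(2)[of x] \<open>\<epsilon> > 0\<close>
      by (cases "\<rho>' x = 0") auto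
    note 4 = young_inequality[OF \<open>\<epsilon> > 0\<close>, of "norm (\<eta> x)" "\<bar>\<rho>' x\<bar> * norm (g x)"]
    show ?thesis
      using 1 2 3 4 unfolding r2 d_def
      by (simp add: power_mult_distrib distrib_left add_divide_distrib)
  qed
  have "((\<lambda>x. Re (D x) + 1/2 * (norm (F x - \<rho> x * cnj (f x)))\<^sup>2
      + \<epsilon> * ((\<tau> x)\<^sup>2 * (norm (H x))\<^sup>2 + (norm (\<eta> x))\<^sup>2)
      + 1 / (4 * \<epsilon>) * ((\<rho>' x)\<^sup>2 * ((norm (f x))\<^sup>2 + (norm (g x))\<^sup>2))) has_integral
    (0 + 1/2 * integral {p..q} (\<lambda>x. (norm (F x - \<rho> x * cnj (f x)))\<^sup>2)
    + \<epsilon> * (integral {p..q} (\<lambda>x. (\<tau> x)\<^sup>2 * (norm (H x))\<^sup>2) + integral {p..q} (\<lambda>x. (norm (\<eta> x))\<^sup>2))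
    + 1 / (4 * \<epsilon>) * integral {p..q} (\<lambda>x. (\<rho>' x)\<^sup>2 * ((norm (f x))\<^sup>2 + (norm (g x))\<^sup>2)))) {p..q}"
    by (intro has_integral_add has_integral_mult_right D0 integrable_integral int F)
  from has_integral_le[OF has_integral_mult_right[OF integrable_integral[OF int(2)], of "1/2"] this] pt
  show ?thesis by simp
qed

section \<open>From the operator domain to a uniform bound on windows\<close>

lemma hamiltonian0_first_order_system:
  assumes "(\<eta>, \<phi>) \<in> hamiltonian0 a b V0"
  shows "first_order_system E (\<lambda>x. \<phi> x - E * \<eta> x) \<eta> (\<lambda>x. - vd \<eta> x + of_real (w x) * \<eta> x)"
proof (rule first_order_systemI)
  fix x assume x: "x \<in> I"
  have tw: "\<eta> twice_differentiable_on I" and \<phi>: "\<phi> x = - vd (vd \<eta>) x + V0 x *\<^sub>R \<eta> x"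
    using assms x by (auto simp: hamiltonian0_def schroedinger_def)
  note tw = twice_differentiable_onD[OF tw x]
  show "(\<eta> has_vector_derivative vd \<eta> x) (at x)" by (rule tw)
  show "(vd \<eta> has_vector_derivative V0 x *\<^sub>R \<eta> x - E * \<eta> x - (\<phi> x - E * \<eta> x)) (at x)"
    using tw(2) by (simp add: \<phi>)
qed

text \<open>All quantities are compared with \<open>N\<close>, the integral of
  \<open>\<rho>^2 |f|^2\<close>. The resolvent bounds \<open>\<eta>\<close> and the Caccioppoli
  estimate bounds \<open>H\<close> by multiples of \<open>N\<close> that do not see the window. With
  \<open>\<epsilon>\<close> small these are absorbed, and only the two unit intervals where
  \<open>\<rho>\<close> varies contribute to the result.\<close>

lemma window_estimate:
  assumes spec: "E \<notin> spec a b V0" and sol: "solution E f g"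
  shows "\<exists>K. \<forall>s t B. s \<le> t \<and> a < ereal (s - 2) \<and> ereal (t + 2) < b \<and>
    (\<forall>x\<in>{s - 1..s} \<union> {t..t + 1}. norm (f x) \<le> B \<and> norm (g x) \<le> B) \<longrightarrow>
    integral {s..t} (\<lambda>x. (norm (f x))\<^sup>2) \<le> K * B\<^sup>2"
proof -
  obtain C where C: "\<And>\<eta> \<phi>. (\<eta>, \<phi>) \<in> hamiltonian0 a b V0 \<Longrightarrow>
      (L2_norm I \<eta>)\<^sup>2 \<le> C * (L2_norm I (\<lambda>x. \<phi> x - E * \<eta> x))\<^sup>2" "0 \<le> C"
    using resolvent_set_hamiltonianD[OF spec] by blast
  \<comment> \<open>\<open>K1\<close> is the Caccioppoli constant. \<open>K2 * N\<close> bounds the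
    weighted integral of \<open>|H|^2\<close> plus that of \<open>|\<eta>|^2\<close>; the summand 1
    in \<open>K2\<close> makes it positive.\<close>
  define K1 where "K1 = 2 * (9 + norm (E - \<alpha>))"
  define K2 where "K2 = K1 * (3 * C + 3) + 3 * C + 1"
  have K: "K1 \<ge> 0" "K2 > 0" using C(2) by (auto simp: K1_def K2_def intro!: add_nonneg_pos)
  have main: "integral {s..t} (\<lambda>x. (norm (f x))\<^sup>2) \<le> 128 * K2 * B\<^sup>2"
    if st: "s \<le> t" "a < ereal (s - 2)" "ereal (t + 2) < b"
      and B: "\<And>x. x \<in> {s - 1..s} \<union> {t..t + 1} \<Longrightarrow> norm (f x) \<le> B \<and> norm (g x) \<le> B" for s t B
  proof -
    \<comment> \<open>The margin 2 on each side has one unit for the slope of \<open>\<rho>\<close>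
      and a further one for the slope of \<open>\<tau>\<close>.\<close>
    let ?J = "{s - 2..t + 2}"
    have J: "s - 2 \<le> t + 2" "?J \<subseteq> I" using st einterval_Icc_subset by auto
    obtain \<rho> \<rho>' :: "real \<Rightarrow> real" where \<rho>:
      "\<And>x. (\<rho> has_real_derivative \<rho>' x) (at x)" "continuous_on UNIV \<rho>'"
      "\<And>x. 0 \<le> \<rho> x" "\<And>x. \<rho> x \<le> 1" "\<And>x. x \<in> {s..t} \<Longrightarrow> \<rho> x = 1"
      "\<And>x. x \<notin> {s - 1<..<t + 1} \<Longrightarrow> \<rho> x = 0" "\<And>x. \<bar>\<rho>' x\<bar> \<le> 2"
      "\<And>x. x \<notin> {s - 1..s} \<union> {t..t + 1} \<Longrightarrow> \<rho>' x = 0"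
      by (rule cutoff_exists[OF st(1)]) (rule that)
    have st1: "s - 1 \<le> t + 1" using st(1) by simp
    \<comment> \<open>A wider cutoff, equal to 1 wherever \<open>\<rho>\<close> varies, so that the
      Caccioppoli estimate controls \<open>H\<close> there.\<close>
    obtain \<tau> \<tau>' :: "real \<Rightarrow> real" where \<tau>:
      "\<And>x. (\<tau> has_real_derivative \<tau>' x) (at x)"
      "\<And>x. 0 \<le> \<tau> x" "\<And>x. \<tau> x \<le> 1" "\<And>x. x \<in> {s - 1..t + 1} \<Longrightarrow> \<tau> x = 1"
      "\<And>x. x \<notin> {s - 1 - 1<..<t + 1 + 1} \<Longrightarrow> \<tau> x = 0" "\<And>x. \<bar>\<tau>' x\<bar> \<le> 2"
      by (rule cutoff_exists[OF st1]) (rule that)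
    have c: "continuous_on I f" "continuous_on I g" "continuous_on UNIV \<rho>" "continuous_on UNIV \<tau>"
      using first_order_system_continuous[OF sol] DERIV_continuous_on[OF \<rho>(1)] DERIV_continuous_on[OF \<tau>(1)]
      by auto
    have cJ: "continuous_on ?J f" "continuous_on ?J g" "continuous_on ?J \<rho>"
      using c J(2) by (auto intro: continuous_on_subset)
    define N where "N = integral ?J (\<lambda>x. (\<rho> x)\<^sup>2 * (norm (f x))\<^sup>2)"
    have intN: "(\<lambda>x. (\<rho> x)\<^sup>2 * (norm (f x))\<^sup>2) integrable_on ?J"
      by (intro integrable_continuous_real continuous_intros cJ)
    have "integral {s..t} (\<lambda>x. (norm (f x))\<^sup>2) = integral {s..t} (\<lambda>x. (\<rho> x)\<^sup>2 * (norm (f x))\<^sup>2)"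
      by (intro integral_cong) (simp add: \<rho>(5))
    also have "\<dots> \<le> N"
      unfolding N_def
      by (intro integral_subset_le intN integrable_subinterval_real[OF intN]) auto
    finally have le_N: "integral {s..t} (\<lambda>x. (norm (f x))\<^sup>2) \<le> N" .
    have "N \<ge> 0" unfolding N_def by (intro integral_nonneg intN) simp
    show ?thesis
    proof (cases "N = 0")
      \<comment> \<open>The approximation in the other case uses the tolerance \<open>N / 4\<close>,
        which has to be positive.\<close>
      case True
      show ?thesis
        by (rule order_trans[OF le_N]) (use True K(2) in simp)
    next
      case False
      with \<open>N \<ge> 0\<close> have "N > 0" by simp
      define k where "k x = of_real (\<rho> x) * cnj (f x)" for x
      have ck: "continuous_on I k"
        unfolding k_def using c by (intro continuous_intros) (auto intro: continuous_on_subset)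
      have k0: "x \<in> einterval a (s - 2) \<union> einterval (t + 2) b \<Longrightarrow> k x = 0" for x
        using st(1) \<rho>(6)[of x] by (auto simp: k_def einterval_iff)
      have z: "(\<lambda>x::real. 0::real) absolutely_integrable_on A" for A by simp
      have kL2: "k \<in> L2 I"
      proof (rule L2_einterval_split[OF ck st(2) J(1) st(3)])
        show "(\<lambda>x. (norm (k x))\<^sup>2) absolutely_integrable_on einterval a (s - 2)"
          using z by (rule set_integrable_cong[THEN iffD1, rotated -1]) (auto simp: k0)
        show "(\<lambda>x. (norm (k x))\<^sup>2) absolutely_integrable_on einterval (t + 2) b"
          using z by (rule set_integrable_cong[THEN iffD1, rotated -1]) (auto simp: k0)
      qed
      have "(L2_norm I k)\<^sup>2 = integral I (\<lambda>x. (norm (k x))\<^sup>2)"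
        by (rule L2_norm_square[OF kL2]) simp
      also have "\<dots> = integral ?J (\<lambda>x. (norm (k x))\<^sup>2)"
      proof (rule integral_spike_set)
        have "{x \<in> I - ?J. (norm (k x))\<^sup>2 \<noteq> 0} = {}" "{x \<in> ?J - I. (norm (k x))\<^sup>2 \<noteq> 0} = {}"
          using J(2) k0 by (auto simp: einterval_iff not_le)
        then show "negligible {x \<in> I - ?J. (norm (k x))\<^sup>2 \<noteq> 0}" "negligible {x \<in> ?J - I. (norm (k x))\<^sup>2 \<noteq> 0}"
          by (simp_all only: negligible_empty)
      qed
      also have "\<dots> = N"
        unfolding N_def k_def by (simp add: norm_mult power_mult_distrib)
      finally have kN: "(L2_norm I k)\<^sup>2 = N" .
      obtain \<eta> \<phi> where \<eta>: "(\<eta>, \<phi>) \<in> hamiltonian0 a b V0"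
        "(L2_norm I (\<lambda>x. \<phi> x - E * \<eta> x - k x))\<^sup>2 < N / 4"
        using resolvent_set_dense_range[OF spec kL2, of "N / 4"] \<open>N > 0\<close> by auto
      define F where "F x = \<phi> x - E * \<eta> x" for x
      define H where "H x = - vd \<eta> x + of_real (w x) * \<eta> x" for x
      have in_L2: "\<eta> \<in> L2 I" "\<phi> \<in> L2 I" using \<eta>(1) by (auto simp: hamiltonian0_def)
      have FL2: "F \<in> L2 I" using L2_linear(1)[OF in_L2(2,1), of 1 "- E"] by (simp add: F_def[abs_def])
      have FkL2: "(\<lambda>x. F x - k x) \<in> L2 I" using L2_linear(1)[OF FL2 kL2, of 1 "- 1"] by simp
      have sys: "first_order_system E F \<eta> H"
        unfolding F_def[abs_def] H_def[abs_def] by (rule hamiltonian0_first_order_system[OF \<eta>(1)])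
      have Fk: "(L2_norm I (\<lambda>x. F x - k x))\<^sup>2 \<le> N / 4"
        using \<eta>(2) by (simp add: F_def)
      \<comment> \<open>The right side is at most \<open>2 * (N / 4) + 2 * N\<close>, rounded up to
        \<open>3 * N\<close>.\<close>
      have "(L2_norm I F)\<^sup>2 \<le> 2 * (L2_norm I (\<lambda>x. F x - k x))\<^sup>2 + 2 * (L2_norm I k)\<^sup>2"
        using L2_linear(2)[OF FkL2 kL2, of 1 1] by simp
      with Fk kN have FN: "(L2_norm I F)\<^sup>2 \<le> 3 * N" using \<open>N > 0\<close> by simp
      have "(L2_norm I \<eta>)\<^sup>2 \<le> C * (L2_norm I F)\<^sup>2" using C(1)[OF \<eta>(1)] by (simp add: F_def[abs_def])
      also have "\<dots> \<le> C * (3 * N)" by (intro mult_left_mono FN C)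
      finally have \<eta>N: "(L2_norm I \<eta>)\<^sup>2 \<le> 3 * C * N" by simp
      note L2J = L2_square_integrable[OF _ sets_lebesgue_einterval J(2)]
      have iN: "integral ?J (\<lambda>x. (norm (\<eta> x))\<^sup>2) \<le> 3 * C * N" "integral ?J (\<lambda>x. (norm (F x))\<^sup>2) \<le> 3 * N"
        "integral ?J (\<lambda>x. (norm (F x - k x))\<^sup>2) \<le> N / 4"
        using L2J(2)[OF in_L2(1)] L2J(2)[OF FL2] L2J(2)[OF FkL2] \<eta>N FN Fk by linarith+
      have "integral ?J (\<lambda>x. (\<tau> x)\<^sup>2 * (norm (H x))\<^sup>2) \<le>
          K1 * (integral ?J (\<lambda>x. (norm (\<eta> x))\<^sup>2) + integral ?J (\<lambda>x. (norm (F x))\<^sup>2))"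
        unfolding K1_def
        by (rule caccioppoli[OF sys J \<tau>(1,2,3,6)]) (use \<tau>(5) L2J(1)[OF FL2] in auto)
      also have "\<dots> \<le> K1 * (3 * C * N + 3 * N)"
        using iN K(1) by (intro mult_left_mono add_mono) auto
      finally have HN: "integral ?J (\<lambda>x. (\<tau> x)\<^sup>2 * (norm (H x))\<^sup>2) \<le> K1 * (3 * C * N + 3 * N)" .
      define R where "R = integral ?J (\<lambda>x. (\<rho>' x)\<^sup>2 * ((norm (f x))\<^sup>2 + (norm (g x))\<^sup>2))"
      \<comment> \<open>This choice bounds the absorbed term by \<open>N / 4\<close>. The duality
        estimate then reads \<open>N / 2 \<le> N / 8 + N / 4 + K2 * R\<close>, that is
        \<open>N \<le> 8 * (K2 * R)\<close>.\<close>
      define \<epsilon> where "\<epsilon> = 1 / (4 * K2)"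
      have \<epsilon>: "\<epsilon> > 0" "1 / (4 * \<epsilon>) = K2" "\<epsilon> * (K2 * N) = N / 4"
        using K(2) by (auto simp: \<epsilon>_def)
      have "1/2 * N \<le> 1/2 * integral ?J (\<lambda>x. (norm (F x - k x))\<^sup>2)
          + \<epsilon> * (integral ?J (\<lambda>x. (\<tau> x)\<^sup>2 * (norm (H x))\<^sup>2) + integral ?J (\<lambda>x. (norm (\<eta> x))\<^sup>2))
          + 1 / (4 * \<epsilon>) * R"
        unfolding N_def k_def R_def
      proof (rule duality_estimate[OF sol sys J \<rho>(1,2)])
        show "\<rho> (s - 2) = 0" "\<rho> (t + 2) = 0" using \<rho>(6) by auto
        show "\<tau> x = 1" if "\<rho>' x \<noteq> 0" for x
          using that \<rho>(8)[of x] \<tau>(4)[of x] st(1) by fastforce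
        show "(\<lambda>x. (norm (F x - of_real (\<rho> x) * cnj (f x)))\<^sup>2) integrable_on ?J"
          using L2J(1)[OF FkL2] by (simp add: k_def)
      qed (use c \<epsilon> in auto)
      also have "\<dots> \<le> 1/2 * (N / 4) + \<epsilon> * (K1 * (3 * C * N + 3 * N) + 3 * C * N) + K2 * R"
        unfolding \<epsilon>(2) using iN HN \<epsilon>(1) K(2) by (intro add_mono mult_left_mono) auto
      finally have "1/2 * N \<le> 1/2 * (N / 4) + \<epsilon> * (K1 * (3 * C * N + 3 * N) + 3 * C * N) + K2 * R" .
      moreover have "\<epsilon> * (K1 * (3 * C * N + 3 * N) + 3 * C * N) \<le> \<epsilon> * (K2 * N)"
        unfolding K2_def using \<open>N > 0\<close> \<epsilon>(1) by (intro mult_left_mono) (simp_all add: algebra_simps)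
      ultimately have NR: "N \<le> 8 * (K2 * R)"
        unfolding \<epsilon>(3) using K(2) by linarith
      \<comment> \<open>The square of the slope is at most 4 and \<open>|f|^2 + |g|^2\<close> at
        most \<open>2 * B^2\<close>, on two intervals of length one. The resulting 16 times the 8
        above is the constant 128.\<close>
      have "R \<le> 8 * B\<^sup>2 * (1 + 1)"
        unfolding R_def
      proof (rule has_integral_le[OF integrable_integral])
        show "(\<lambda>x. (\<rho>' x)\<^sup>2 * ((norm (f x))\<^sup>2 + (norm (g x))\<^sup>2)) integrable_on ?J"
          by (intro integrable_continuous_real continuous_intros cJ continuous_on_subset[OF \<rho>(2)]) auto
        have one: "((\<lambda>x. if x \<in> {p..p + 1} then 1 else 0 :: real) has_integral 1) ?J"
          if "{p..p + 1} \<subseteq> ?J" for p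
          unfolding has_integral_restrict[OF that] using has_integral_const_real[of "1::real" p "p + 1"] by simp
        have "{s - 1..s - 1 + 1} \<subseteq> ?J" "{t..t + 1} \<subseteq> ?J" using st(1) by auto
        from one[OF this(1)] one[OF this(2)]
        show "((\<lambda>x. 8 * B\<^sup>2 * ((if x \<in> {s - 1..s - 1 + 1} then 1 else 0) + (if x \<in> {t..t + 1} then 1 else 0)))
            has_integral 8 * B\<^sup>2 * (1 + 1)) ?J"
          by (intro has_integral_mult_right has_integral_add)
        show "(\<rho>' x)\<^sup>2 * ((norm (f x))\<^sup>2 + (norm (g x))\<^sup>2) \<le>
            8 * B\<^sup>2 * ((if x \<in> {s - 1..s - 1 + 1} then 1 else 0) + (if x \<in> {t..t + 1} then 1 else 0))" for x
        proof (cases "x \<in> {s - 1..s} \<union> {t..t + 1}")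
          case True
          have "(\<rho>' x)\<^sup>2 \<le> 2\<^sup>2" using \<rho>(7)[of x] by (metis abs_ge_zero power2_abs power_mono)
          moreover have "(norm (f x))\<^sup>2 + (norm (g x))\<^sup>2 \<le> B\<^sup>2 + B\<^sup>2"
            using B[OF True] by (intro add_mono power_mono) auto
          ultimately have "(\<rho>' x)\<^sup>2 * ((norm (f x))\<^sup>2 + (norm (g x))\<^sup>2) \<le> 2\<^sup>2 * (B\<^sup>2 + B\<^sup>2)"
            by (intro mult_mono) auto
          also have "\<dots> = 8 * B\<^sup>2 * 1" by simp
          also have "\<dots> \<le> 8 * B\<^sup>2 * ((if x \<in> {s - 1..s - 1 + 1} then 1 else 0) + (if x \<in> {t..t + 1} then 1 else 0))"
            using True by (intro mult_left_mono) auto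
          finally show ?thesis .
        qed (simp add: \<rho>(8))
      qed
      then have "K2 * R \<le> K2 * (16 * B\<^sup>2)"
        using K(2) by (intro mult_left_mono) auto
      with le_N NR show ?thesis by simp
    qed
  qed
  show ?thesis
    by (intro exI[of _ "128 * K2"] allI impI) (rule main, auto)
qed


section \<open>Square integrability at the endpoints\<close>

text \<open>The superpotential cancels because it enters the two equations of the system with
  opposite signs. This yields both the constancy of the Wronskian and an antiderivative for the
  difference of the Green functions.\<close>

lemma has_vector_derivative_cross:
  assumes "solution E f1 g1" "solution E f2 g2" "x \<in> I"
  shows "((\<lambda>x. f1 x * g2 x) has_vector_derivative (E - \<alpha>) * f1 x * f2 x - g1 x * g2 x) (at x)"
  using has_vector_derivative_mult[OF first_order_systemD(1)[OF assms(1,3)] first_order_systemD(2)[OF assms(2,3)]]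
  by (rule back_subst) (simp add: algebra_simps)

text \<open>The derivative of \<open>cnj f g\<close> is \<open>(E - \<alpha>) |f|^2 - |g|^2\<close>.
  Integrated, it trades \<open>|g|^2\<close> for \<open>|f|^2\<close> up to two boundary terms of
  size at most 1.\<close>

lemma integral_partner_le:
  assumes sol: "solution E f g" and "s \<le> t" "{s..t} \<subseteq> I"
    and B: "\<And>x. x \<in> {s..t} \<Longrightarrow> norm (f x) \<le> 1 \<and> norm (g x) \<le> 1"
  shows "integral {s..t} (\<lambda>x. (norm (g x))\<^sup>2) \<le> norm (E - \<alpha>) * integral {s..t} (\<lambda>x. (norm (f x))\<^sup>2) + 2"
proof -
  define P where "P x = cnj (f x) * g x" for x
  define D where "D x = (E - \<alpha>) * of_real ((norm (f x))\<^sup>2) - of_real ((norm (g x))\<^sup>2)" for x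
  have dP: "(P has_vector_derivative D x) (at x)" if "x \<in> I" for x
    unfolding P_def[abs_def] D_def complex_norm_square
    using has_vector_derivative_mult[OF has_vector_derivative_cnj[OF first_order_systemD(1)[OF sol that]]
        first_order_systemD(2)[OF sol that]]
    by (rule back_subst) (simp add: algebra_simps)
  have "(D has_integral (P t - P s)) {s..t}"
    by (rule fundamental_theorem_of_calculus[OF assms(2) has_vector_derivative_at_within[OF dP[OF subsetD[OF assms(3)]]]])
  from has_integral_Re[OF this]
  have 1: "((\<lambda>x. Re (E - \<alpha>) * (norm (f x))\<^sup>2 - (norm (g x))\<^sup>2) has_integral Re (P t - P s)) {s..t}"
    by (simp only: D_def minus_complex.sel times_complex.sel Re_complex_of_real Im_complex_of_real mult_zero_right diff_zero)
  have c: "continuous_on {s..t} f" "continuous_on {s..t} g"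
    using first_order_system_continuous[OF sol] assms(3) by (auto intro: continuous_on_subset)
  have int: "(\<lambda>x. (norm (f x))\<^sup>2) integrable_on {s..t}" "(\<lambda>x. (norm (g x))\<^sup>2) integrable_on {s..t}"
    by (intro integrable_continuous_real continuous_intros c)+
  have "((\<lambda>x. Re (E - \<alpha>) * (norm (f x))\<^sup>2 - (norm (g x))\<^sup>2) has_integral
    Re (E - \<alpha>) * integral {s..t} (\<lambda>x. (norm (f x))\<^sup>2) - integral {s..t} (\<lambda>x. (norm (g x))\<^sup>2)) {s..t}"
    by (intro has_integral_diff has_integral_mult_right integrable_integral int)
  from has_integral_unique[OF 1 this]
  have "integral {s..t} (\<lambda>x. (norm (g x))\<^sup>2) = Re (E - \<alpha>) * integral {s..t} (\<lambda>x. (norm (f x))\<^sup>2) - Re (P t - P s)"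
    by simp
  moreover have "Re (E - \<alpha>) * integral {s..t} (\<lambda>x. (norm (f x))\<^sup>2) \<le> norm (E - \<alpha>) * integral {s..t} (\<lambda>x. (norm (f x))\<^sup>2)"
    by (intro mult_right_mono complex_Re_le_cmod integral_nonneg int) simp
  moreover have "norm (P x) \<le> 1" if "x \<in> {s..t}" for x
    using B[OF that] by (simp add: P_def norm_mult mult_le_one)
  from this[of s] this[of t] have "- Re (P t - P s) \<le> 2"
    using norm_triangle_ineq4[of "P t" "P s"] assms(2)
      abs_Re_le_cmod[of "P t - P s"] by simp
  ultimately show ?thesis by linarith
qed

text \<open>The first alternative serves finite endpoints, where boundedness on a bounded interval
  suffices. The second serves infinite ones: every window inside has room for the cutoffs and data
  bounded by 1 on their slopes, so \<open>window_estimate\<close> applies with \<open>B = 1\<close>.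
  The bound for \<open>g\<close> follows from that for \<open>f\<close>.\<close>

lemma square_integrable_subinterval:
  assumes spec: "E \<notin> spec a b V0" and sol: "solution E f g"
    and pq: "p < q" "einterval p q \<subseteq> I"
    and B: "\<And>x. x \<in> einterval p q \<Longrightarrow> norm (f x) \<le> 1 \<and> norm (g x) \<le> 1"
    and cases: "(\<exists>r r'. p = ereal r \<and> q = ereal r') \<or>
      (\<forall>x\<in>einterval p q. a < ereal (x - 2) \<and> ereal (x + 2) < b \<and>
        (\<forall>y\<in>{x - 1..x + 1}. norm (f y) \<le> 1 \<and> norm (g y) \<le> 1))"
  shows "(\<lambda>x. (norm (f x))\<^sup>2) absolutely_integrable_on einterval p q"
    and "(\<lambda>x. (norm (g x))\<^sup>2) absolutely_integrable_on einterval p q"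
proof -
  have c: "continuous_on (einterval p q) f" "continuous_on (einterval p q) g"
    using first_order_system_continuous[OF sol] pq(2) by (auto intro: continuous_on_subset)
  have "\<exists>M. \<forall>s t. p < ereal s \<longrightarrow> s \<le> t \<longrightarrow> ereal t < q \<longrightarrow> integral {s..t} (\<lambda>x. (norm (f x))\<^sup>2) \<le> M"
    using cases
  proof
    assume "\<exists>r r'. p = ereal r \<and> q = ereal r'"
    then obtain r r' where r: "p = ereal r" "q = ereal r'" by blast
    show ?thesis
    proof (intro exI allI impI)
      fix s t assume st: "p < ereal s" "s \<le> t" "ereal t < q"
      note sub = einterval_Icc_subset[OF st(1,3)]
      have "integral {s..t} (\<lambda>x. (norm (f x))\<^sup>2) \<le> integral {s..t} (\<lambda>x. 1)"
      proof (rule integral_le)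
        show "(\<lambda>x. (norm (f x))\<^sup>2) integrable_on {s..t}"
          by (intro integrable_continuous_real continuous_intros continuous_on_subset[OF c(1) sub])
        show "(norm (f x))\<^sup>2 \<le> 1" if "x \<in> {s..t}" for x
          using B[of x] sub that by (auto simp: power_le_one)
      qed auto
      also have "\<dots> \<le> r' - r" using st r by simp
      finally show "integral {s..t} (\<lambda>x. (norm (f x))\<^sup>2) \<le> r' - r" .
    qed
  next
    assume *: "\<forall>x\<in>einterval p q. a < ereal (x - 2) \<and> ereal (x + 2) < b \<and>
        (\<forall>y\<in>{x - 1..x + 1}. norm (f y) \<le> 1 \<and> norm (g y) \<le> 1)"
    obtain K where K: "\<forall>s t B. s \<le> t \<and> a < ereal (s - 2) \<and> ereal (t + 2) < b \<and>
      (\<forall>x\<in>{s - 1..s} \<union> {t..t + 1}. norm (f x) \<le> B \<and> norm (g x) \<le> B) \<longrightarrow>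
      integral {s..t} (\<lambda>x. (norm (f x))\<^sup>2) \<le> K * B\<^sup>2"
      using window_estimate[OF spec sol] by blast
    show ?thesis
    proof (intro exI allI impI)
      fix s t assume st: "p < ereal s" "s \<le> t" "ereal t < q"
      have "s \<in> einterval p q" "t \<in> einterval p q"
        using einterval_Icc_subset[OF st(1,3)] st(2) by auto
      note s = bspec[OF * this(1)] and t = bspec[OF * this(2)]
      have "integral {s..t} (\<lambda>x. (norm (f x))\<^sup>2) \<le> K * 1\<^sup>2"
        by (rule K[rule_format]) (use s t st(2) in auto)
      then show "integral {s..t} (\<lambda>x. (norm (f x))\<^sup>2) \<le> K" by simp
    qed
  qed
  then obtain M where M: "\<And>s t. p < ereal s \<Longrightarrow> s \<le> t \<Longrightarrow> ereal t < q \<Longrightarrow>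
      integral {s..t} (\<lambda>x. (norm (f x))\<^sup>2) \<le> M" by blast
  show "(\<lambda>x. (norm (f x))\<^sup>2) absolutely_integrable_on einterval p q"
    by (rule nonneg_integrable_on_einterval[OF pq(1) _ _ M]) (auto intro!: continuous_intros c)
  show "(\<lambda>x. (norm (g x))\<^sup>2) absolutely_integrable_on einterval p q"
  proof (rule nonneg_integrable_on_einterval[OF pq(1)])
    fix s t assume st: "p < ereal s" "s \<le> t" "ereal t < q"
    note sub = einterval_Icc_subset[OF st(1,3)]
    have "integral {s..t} (\<lambda>x. (norm (g x))\<^sup>2) \<le> norm (E - \<alpha>) * integral {s..t} (\<lambda>x. (norm (f x))\<^sup>2) + 2"
      using sub pq(2) B by (intro integral_partner_le[OF sol st(2)]) auto
    also have "\<dots> \<le> norm (E - \<alpha>) * M + 2"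
      by (intro add_mono mult_left_mono M st) auto
    finally show "integral {s..t} (\<lambda>x. (norm (g x))\<^sup>2) \<le> norm (E - \<alpha>) * M + 2" .
  qed (auto intro!: continuous_intros c)
qed

text \<open>The limits serve to bound \<open>f\<close> and \<open>g\<close> by 1 near the endpoint;
  the remaining piece up to \<open>c\<close> is compact.\<close>

lemma square_integrable_left:
  assumes spec: "E \<notin> spec a b V0" and sol: "solution E f g"
    and lim: "(f \<longlongrightarrow> 0) (left_end a)" "(g \<longlongrightarrow> 0) (left_end a)" and c: "c \<in> I"
  shows "(\<lambda>x. (norm (f x))\<^sup>2) absolutely_integrable_on einterval a c"
    and "(\<lambda>x. (norm (g x))\<^sup>2) absolutely_integrable_on einterval a c"
proof -
  have "eventually (\<lambda>x. norm (f x) < 1 \<and> norm (g x) < 1) (left_end a)"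
    using order_tendstoD(2)[OF tendsto_norm_zero[OF lim(1)], of 1]
      order_tendstoD(2)[OF tendsto_norm_zero[OF lim(2)], of 1] by (simp add: eventually_conj)
  then obtain c1 where c1: "a < ereal c1" "\<And>x. a < ereal x \<Longrightarrow> x < c1 \<Longrightarrow> norm (f x) < 1 \<and> norm (g x) < 1"
    unfolding eventually_left_end[OF ab] by auto
  define m where "m = min c c1"
  have m: "a < ereal m" "m \<le> c" "m \<le> c1" using c c1 by (auto simp: m_def min_def einterval_iff)
  \<comment> \<open>At an infinite endpoint the margin 3 keeps \<open>x + 1\<close> below
    \<open>m\<close>, where the bound 1 is valid, and \<open>x + 2\<close> below \<open>b\<close>,
    for every \<open>x < d\<close>.\<close>
  have "\<exists>d. a < ereal d \<and> d \<le> m \<and> ((\<exists>r. a = ereal r) \<or> d \<le> m - 3)"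
  proof (cases a)
    case MInf
    then show ?thesis by (intro exI[of _ "m - 3"]) auto
  qed (use m in auto)
  then obtain d where d: "a < ereal d" "d \<le> m" "(\<exists>r. a = ereal r) \<or> d \<le> m - 3" by blast
  have dI: "d \<in> I"
    using d m c einterval_between[of a d c b d] by (auto simp: einterval_iff)
  have sub: "einterval a d \<subseteq> I"
    using einterval_between[of a _ d b] dI by (auto simp: einterval_iff)
  have B: "norm (f x) \<le> 1 \<and> norm (g x) \<le> 1" if "a < ereal x" "x < m" for x
    using c1(2)[of x] that m(3) by auto
  have cs: "(\<exists>r r'. a = ereal r \<and> ereal d = ereal r') \<or>
      (\<forall>x\<in>einterval a d. a < ereal (x - 2) \<and> ereal (x + 2) < b \<and>
        (\<forall>y\<in>{x - 1..x + 1}. norm (f y) \<le> 1 \<and> norm (g y) \<le> 1))"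
  proof (cases "\<exists>r. a = ereal r")
    case False
    with ab have a: "a = - \<infinity>" by (cases a) auto
    have d3: "d \<le> m - 3" using d(3) False by blast
    have "ereal c < b" using c by (simp add: einterval_iff)
    have "ereal (x + 2) < b" if "x < d" for x
      using that d3 m(2) le_less_trans[OF _ \<open>ereal c < b\<close>, of "ereal (x + 2)"] by simp
    then show ?thesis
      using d3 B unfolding a by (auto simp: einterval_iff)
  qed auto
  have B': "norm (f x) \<le> 1 \<and> norm (g x) \<le> 1" if "x \<in> einterval a d" for x
    using that B[of x] d(2) by (auto simp: einterval_iff)
  note L = square_integrable_subinterval[OF spec sol d(1) sub B' cs]
  have cont: "continuous_on I (\<lambda>x. (norm (f x))\<^sup>2)" "continuous_on I (\<lambda>x. (norm (g x))\<^sup>2)"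
    using first_order_system_continuous[OF sol] by (auto intro!: continuous_intros)
  show "(\<lambda>x. (norm (f x))\<^sup>2) absolutely_integrable_on einterval a c"
    by (rule absolutely_integrable_einterval_extend(1)[OF cont(1) c dI L(1)])
  show "(\<lambda>x. (norm (g x))\<^sup>2) absolutely_integrable_on einterval a c"
    by (rule absolutely_integrable_einterval_extend(1)[OF cont(2) c dI L(2)])
qed

lemma square_integrable_right:
  assumes spec: "E \<notin> spec a b V0" and sol: "solution E f g"
    and lim: "(f \<longlongrightarrow> 0) (right_end b)" "(g \<longlongrightarrow> 0) (right_end b)" and c: "c \<in> I"
  shows "(\<lambda>x. (norm (f x))\<^sup>2) absolutely_integrable_on einterval c b"
    and "(\<lambda>x. (norm (g x))\<^sup>2) absolutely_integrable_on einterval c b"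
proof -
  have "eventually (\<lambda>x. norm (f x) < 1 \<and> norm (g x) < 1) (right_end b)"
    using order_tendstoD(2)[OF tendsto_norm_zero[OF lim(1)], of 1]
      order_tendstoD(2)[OF tendsto_norm_zero[OF lim(2)], of 1] by (simp add: eventually_conj)
  then obtain c1 where c1: "ereal c1 < b" "\<And>x. ereal x < b \<Longrightarrow> c1 < x \<Longrightarrow> norm (f x) < 1 \<and> norm (g x) < 1"
    unfolding eventually_right_end[OF ab] by auto
  define m where "m = max c c1"
  have m: "ereal m < b" "c \<le> m" "c1 \<le> m" using c c1 by (auto simp: m_def max_def einterval_iff)
  have "\<exists>d. ereal d < b \<and> m \<le> d \<and> ((\<exists>r. b = ereal r) \<or> m + 3 \<le> d)"
  proof (cases b)
    case PInf
    then show ?thesis by (intro exI[of _ "m + 3"]) auto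
  qed (use m in auto)
  then obtain d where d: "ereal d < b" "m \<le> d" "(\<exists>r. b = ereal r) \<or> m + 3 \<le> d" by blast
  have dI: "d \<in> I"
    using d m c einterval_between[of a c d b d] by (auto simp: einterval_iff)
  have sub: "einterval d b \<subseteq> I"
    using einterval_between[of a d _ b] dI by (auto simp: einterval_iff)
  have B: "norm (f x) \<le> 1 \<and> norm (g x) \<le> 1" if "ereal x < b" "m < x" for x
    using c1(2)[of x] that m(3) by auto
  have cs: "(\<exists>r r'. ereal d = ereal r \<and> b = ereal r') \<or>
      (\<forall>x\<in>einterval d b. a < ereal (x - 2) \<and> ereal (x + 2) < b \<and>
        (\<forall>y\<in>{x - 1..x + 1}. norm (f y) \<le> 1 \<and> norm (g y) \<le> 1))"
  proof (cases "\<exists>r. b = ereal r")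
    case False
    with ab have b: "b = \<infinity>" by (cases b) auto
    have d3: "m + 3 \<le> d" using d(3) False by blast
    have "a < ereal c" using c by (simp add: einterval_iff)
    have "a < ereal (x - 2)" if "d < x" for x
      using that d3 m(2) less_le_trans[OF \<open>a < ereal c\<close>, of "ereal (x - 2)"] by simp
    then show ?thesis
      using d3 B unfolding b by (auto simp: einterval_iff)
  qed auto
  have B': "norm (f x) \<le> 1 \<and> norm (g x) \<le> 1" if "x \<in> einterval d b" for x
    using that B[of x] d(2) by (auto simp: einterval_iff)
  note L = square_integrable_subinterval[OF spec sol d(1) sub B' cs]
  have cont: "continuous_on I (\<lambda>x. (norm (f x))\<^sup>2)" "continuous_on I (\<lambda>x. (norm (g x))\<^sup>2)"
    using first_order_system_continuous[OF sol] by (auto intro!: continuous_intros)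
  show "(\<lambda>x. (norm (f x))\<^sup>2) absolutely_integrable_on einterval c b"
    by (rule absolutely_integrable_einterval_extend(2)[OF cont(1) c dI L(1)])
  show "(\<lambda>x. (norm (g x))\<^sup>2) absolutely_integrable_on einterval c b"
    by (rule absolutely_integrable_einterval_extend(2)[OF cont(2) c dI L(2)])
qed

section \<open>Uniqueness for the first order system\<close>

text \<open>Gronwall's argument for \<open>N = |f|^2 + |g|^2\<close>: on the compact interval
  between \<open>x\<close> and \<open>y\<close> the continuous \<open>w\<close> is bounded, whence
  \<open>|N'| \<le> C * N\<close>.\<close>

lemma solution_unique:
  assumes sol: "solution E f g" and x: "x \<in> I" "f x = 0" "g x = 0" and y: "y \<in> I"
  shows "f y = 0"
proof -
  define N where "N x = (norm (f x))\<^sup>2 + (norm (g x))\<^sup>2" for x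
  define N' where "N' x = 2 * Re (cnj (f x) * (w x * f x - g x) + cnj (g x) * ((E - \<alpha>) * f x - w x * g x))" for x
  have dN: "(N has_real_derivative N' z) (at z)" if "z \<in> I" for z
  proof -
    note d = first_order_systemD[OF sol that]
    have "((\<lambda>x. cnj (f x) * f x + cnj (g x) * g x) has_vector_derivative
       cnj (f z) * (w z * f z - g z) + cnj (w z * f z - g z) * f z +
       (cnj (g z) * (0 - w z * g z + (E - \<alpha>) * f z) + cnj (0 - w z * g z + (E - \<alpha>) * f z) * g z)) (at z)"
      by (intro has_vector_derivative_add has_vector_derivative_mult has_vector_derivative_cnj d)
    from bounded_linear.has_vector_derivative[OF bounded_linear_Re this]
    have "((\<lambda>x. Re (cnj (f x) * f x + cnj (g x) * g x)) has_vector_derivative N' z) (at z)"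
      by (rule back_subst) (simp add: N'_def algebra_simps)
    moreover have "Re (cnj (f x) * f x + cnj (g x) * g x) = N x" for x
      unfolding N_def cmod_power2 by (simp add: power2_eq_square)
    ultimately show ?thesis
      by (simp add: has_real_derivative_iff_has_vector_derivative)
  qed
  define p q where "p = min x y" "q = max x y"
  have "p \<in> I" "q \<in> I"
    using x(1) y by (auto simp: p_q_def min_def max_def)
  then have pq: "p \<le> q" "{p..q} \<subseteq> I"
    using einterval_Icc_subset[of a p q b] by (auto simp: p_q_def einterval_iff)
  have "continuous_on {p..q} w"
    using continuous_on_vector_derivative[of I w w'] w_deriv pq(2) continuous_on_subset by blast
  then have "bounded (w ` {p..q})"
    by (intro compact_imp_bounded compact_continuous_image) auto
  then obtain M where M: "\<And>z. z \<in> {p..q} \<Longrightarrow> \<bar>w z\<bar> \<le> M"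
    unfolding bounded_iff by (metis image_eqI real_norm_def)
  \<comment> \<open>\<open>2 * M\<close> comes from the terms with \<open>w\<close>; the other two
    summands come from the mixed products, by \<open>|f| |g| \<le> N / 2\<close>. The factor 2 in
    \<open>N'\<close> is included.\<close>
  define C where "C = 2 * M + 1 + norm (E - \<alpha>)"
  have bound: "\<bar>N' z\<bar> \<le> C * N z" if "z \<in> {p..q}" for z
  proof -
    have "cnj (f z) * (w z * f z - g z) + cnj (g z) * ((E - \<alpha>) * f z - w z * g z)
      = of_real (w z * ((norm (f z))\<^sup>2 - (norm (g z))\<^sup>2)) + (- cnj (f z) * g z + (E - \<alpha>) * (cnj (g z) * f z))"
      unfolding of_real_mult of_real_diff complex_norm_square by (simp add: algebra_simps)
    also have "norm \<dots> \<le> \<bar>w z\<bar> * \<bar>(norm (f z))\<^sup>2 - (norm (g z))\<^sup>2\<bar>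
        + (norm (f z) * norm (g z) + norm (E - \<alpha>) * (norm (f z) * norm (g z)))"
      by (intro order_trans[OF norm_triangle_ineq] add_mono)
        (simp_all add: norm_mult abs_mult del: of_real_diff of_real_power of_real_mult)
    also have "\<dots> \<le> M * N z + (N z / 2 + norm (E - \<alpha>) * (N z / 2))"
    proof (intro add_mono mult_mono mult_left_mono)
      show "\<bar>(norm (f z))\<^sup>2 - (norm (g z))\<^sup>2\<bar> \<le> N z" by (simp add: N_def abs_le_iff)
      show "norm (f z) * norm (g z) \<le> N z / 2" "norm (f z) * norm (g z) \<le> N z / 2"
        using sum_squares_bound[of "norm (f z)" "norm (g z)"] by (simp_all add: N_def)
      show "0 \<le> M" using M[OF that] by linarith
    qed (use M[OF that] in auto)
    finally have "norm (cnj (f z) * (w z * f z - g z) + cnj (g z) * ((E - \<alpha>) * f z - w z * g z)) \<le> C * N z / 2"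
      by (simp add: C_def algebra_simps)
    then show ?thesis
      unfolding N'_def using abs_Re_le_cmod[of "cnj (f z) * (w z * f z - g z) + cnj (g z) * ((E - \<alpha>) * f z - w z * g z)"]
      by linarith
  qed
  have "N x = 0" using x by (simp add: N_def)
  \<comment> \<open>With \<open>c = - C\<close> the product decreases, which propagates the zero to
    the right of \<open>x\<close>; with \<open>c = C\<close> it increases, which propagates it to
    the left.\<close>
  have d_exp: "((\<lambda>z. exp (c * z) * N z) has_real_derivative exp (c * z) * (N' z + c * N z)) (at z)" if "z \<in> I" for c z
    by (rule derivative_eq_intros dN[OF that] refl)+ (simp add: algebra_simps)
  have "N y \<le> 0"
  proof (cases "x \<le> y")
    case True
    have "exp (- C * y) * N y \<le> exp (- C * x) * N x"
    proof (rule DERIV_nonpos_imp_nonincreasing[OF True])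
      fix z assume z: "x \<le> z" "z \<le> y"
      then have z': "z \<in> {p..q}" by (auto simp: p_q_def)
      have "exp (- C * z) * (N' z + - C * N z) \<le> 0"
        using bound[OF z'] by (intro mult_nonneg_nonpos) auto
      then show "\<exists>D. ((\<lambda>z. exp (- C * z) * N z) has_real_derivative D) (at z) \<and> D \<le> 0"
        using d_exp[of z "- C"] z' pq(2) by blast
    qed
    then show ?thesis using \<open>N x = 0\<close> by (simp add: mult_le_0_iff)
  next
    case False
    have "exp (C * y) * N y \<le> exp (C * x) * N x"
    proof (rule DERIV_nonneg_imp_nondecreasing[of y x])
      show "y \<le> x" using False by simp
    next
      fix z assume z: "y \<le> z" "z \<le> x"
      then have z': "z \<in> {p..q}" by (auto simp: p_q_def)
      have "0 \<le> exp (C * z) * (N' z + C * N z)"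
        using bound[OF z'] by (intro mult_nonneg_nonneg) auto
      then show "\<exists>D. ((\<lambda>z. exp (C * z) * N z) has_real_derivative D) (at z) \<and> 0 \<le> D"
        using d_exp[of z C] z' pq(2) by blast
    qed
    then show ?thesis using \<open>N x = 0\<close> by (simp add: mult_le_0_iff)
  qed
  then show ?thesis by (simp add: N_def add_nonpos_eq_0_iff sum_power2_le_zero_iff)
qed


section \<open>The trace formula\<close>

lemma wronskian_eq:
  assumes "solution E f1 g1" "solution E f2 g2" "x \<in> I"
  shows "wronskian f1 f2 x = g1 x * f2 x - f1 x * g2 x"
  unfolding wronskian_def vector_derivative_at[OF first_order_systemD(1)[OF assms(1,3)]]
    vector_derivative_at[OF first_order_systemD(1)[OF assms(2,3)]]
  by (simp add: algebra_simps)

lemma wronskian_partner: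
  assumes "solution E f1 g1" "solution E f2 g2" "x \<in> I"
  shows "wronskian g1 g2 x = (E - \<alpha>) * wronskian f1 f2 x"
  unfolding wronskian_eq[OF assms] wronskian_def[of g1 g2]
    vector_derivative_at[OF first_order_systemD(2)[OF assms(1,3)]]
    vector_derivative_at[OF first_order_systemD(2)[OF assms(2,3)]]
  by (simp add: algebra_simps)

text \<open>It is the difference of two cross products \<open>f2 g1\<close> and
  \<open>f1 g2\<close>, whose derivatives coincide by symmetry.\<close>

lemma wronskian_constant:
  assumes "solution E f1 g1" "solution E f2 g2" "x \<in> I" "y \<in> I"
  shows "wronskian f1 f2 x = wronskian f1 f2 y"
proof -
  have d0: "((\<lambda>x. f2 x * g1 x - f1 x * g2 x) has_vector_derivative 0) (at x)" if "x \<in> I" for x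
    using has_vector_derivative_diff[OF has_vector_derivative_cross[OF assms(2,1) that]
        has_vector_derivative_cross[OF assms(1,2) that]]
    by (rule back_subst) (simp add: algebra_simps)
  have d: "((\<lambda>x. f2 x * g1 x - f1 x * g2 x) has_vector_derivative 0) (at x within I)" if "x \<in> I" for x
    by (rule has_vector_derivative_at_within[OF d0[OF that]])
  obtain c where "\<And>x. x \<in> I \<Longrightarrow> f2 x * g1 x - f1 x * g2 x = c"
    by (rule has_vector_derivative_zero_constant[OF convex_einterval d]) (assumption, rule that)
  from this[OF assms(3)] this[OF assms(4)] show ?thesis
    unfolding wronskian_eq[OF assms(1-3)] wronskian_eq[OF assms(1,2,4)] by (simp add: mult.commute)
qed

text \<open>The combination \<open>f1 - c f2\<close> vanishes at \<open>x\<close> by the choice of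
  \<open>c\<close>, and its partner component vanishes there because the Wronskian does. Uniqueness
  makes it zero throughout.\<close>

lemma solution_proportional:
  assumes "solution E f1 g1" "solution E f2 g2" "x \<in> I" "wronskian f1 f2 x = 0" "f2 x \<noteq> 0" "y \<in> I"
  shows "f1 y = f1 x / f2 x * f2 y"
proof -
  define c where "c = f1 x / f2 x"
  have "solution E (\<lambda>x. f1 x - c * f2 x) (\<lambda>x. g1 x - c * g2 x)"
    unfolding first_order_system_def
  proof (intro ballI conjI)
    fix z assume z: "z \<in> I"
    note d = first_order_systemD[OF assms(1) z] first_order_systemD[OF assms(2) z]
    show "((\<lambda>x. f1 x - c * f2 x) has_vector_derivative
        of_real (w z) * (f1 z - c * f2 z) - (g1 z - c * g2 z)) (at z)"
      using has_vector_derivative_diff[OF d(1) has_vector_derivative_mult_right[OF d(3), of c]]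
      by (rule back_subst) (simp add: algebra_simps)
    show "((\<lambda>x. g1 x - c * g2 x) has_vector_derivative
        0 - of_real (w z) * (g1 z - c * g2 z) + (E - \<alpha>) * (f1 z - c * f2 z)) (at z)"
      using has_vector_derivative_diff[OF d(2) has_vector_derivative_mult_right[OF d(4), of c]]
      by (rule back_subst) (simp add: algebra_simps)
  qed
  moreover have "f1 x - c * f2 x = 0" using assms(5) by (simp add: c_def)
  moreover have "g1 x - c * g2 x = 0"
    using assms(4,5) unfolding wronskian_eq[OF assms(1-3)] by (simp add: c_def field_simps)
  ultimately have "f1 y - c * f2 y = 0"
    using solution_unique[OF _ assms(3) _ _ assms(6)] by blast
  then show ?thesis by (simp add: c_def)
qed

text \<open>Such an \<open>f\<close> would belong to the classical domain with
  \<open>(h - E) f = 0\<close>, so the resolvent bound forces its norm to be zero; continuity then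
  contradicts \<open>f x \<noteq> 0\<close>.\<close>

lemma no_square_integrable_solution:
  assumes spec: "E \<notin> spec a b V0" and sol: "solves I V0 E f" and f: "x \<in> I" "f x \<noteq> 0"
    and lim: "(f \<longlongrightarrow> 0) (left_end a)" "(f \<longlongrightarrow> 0) (right_end b)"
    and int: "(\<lambda>x. (norm (f x))\<^sup>2) absolutely_integrable_on einterval a x"
      "(\<lambda>x. (norm (f x))\<^sup>2) absolutely_integrable_on einterval x b"
  shows False
proof -
  have cont: "continuous_on I f"
    by (rule continuous_on_vector_derivative[OF solvesD(1)[OF sol]])
  have L2: "f \<in> L2 I"
    using f(1) by (intro L2_einterval_split[OF cont _ order_refl _ int]) (auto simp: einterval_iff)
  have "(\<lambda>x. E * f x) \<in> L2 I"
    using L2_linear(1)[OF L2 L2, of E 0] by simp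
  with L2 lim sol have dom: "(f, \<lambda>x. E * f x) \<in> hamiltonian0 a b V0"
    by (auto simp: hamiltonian0_def solves_def)
  obtain C where C: "\<And>\<eta> \<phi>. (\<eta>, \<phi>) \<in> hamiltonian0 a b V0 \<Longrightarrow>
      (L2_norm I \<eta>)\<^sup>2 \<le> C * (L2_norm I (\<lambda>x. \<phi> x - E * \<eta> x))\<^sup>2" "0 \<le> C"
    using resolvent_set_hamiltonianD[OF spec] by blast
  from C(1)[OF dom] have "(L2_norm I f)\<^sup>2 \<le> C * (L2_norm I (\<lambda>x. E * f x - E * f x))\<^sup>2" .
  then have norm0: "(L2_norm I f)\<^sup>2 \<le> 0" by (simp add: L2_norm_def)
  obtain e where e: "e > 0" "cball x e \<subseteq> I"
    using open_contains_cball[of I] f(1) by auto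
  then have sub: "{x - e..x + e} \<subseteq> I" by (simp add: cball_eq_atLeastAtMost)
  have "integral {x - e..x + e} (\<lambda>x. (norm (f x))\<^sup>2) \<le> 0"
    using L2_square_integrable(2)[OF L2 _ sub] norm0 by simp
  moreover have "0 \<le> integral {x - e..x + e} (\<lambda>x. (norm (f x))\<^sup>2)"
    by (rule integral_nonneg) (use L2_square_integrable(1)[OF L2 _ sub] in auto)
  ultimately have "integral {x - e..x + e} (\<lambda>x. (norm (f x))\<^sup>2) = 0" by simp
  moreover have "continuous_on {x - e..x + e} (\<lambda>x. (norm (f x))\<^sup>2)"
    by (intro continuous_intros continuous_on_subset[OF cont sub])
  ultimately have "\<forall>y\<in>{x - e..x + e}. (norm (f y))\<^sup>2 = 0"
    using integral_eq_0_iff[of "x - e" "x + e" "\<lambda>x. (norm (f x))\<^sup>2"] e(1) by simp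
  then have "(norm (f x))\<^sup>2 = 0" using e(1) by (elim ballE[of _ _ x]) auto
  with f(2) show False by simp
qed

end

theorem theorem2:
  fixes a b :: ereal and V0 V1 u :: "real \<Rightarrow> real" and \<alpha> :: real and E W0 :: complex
    and G0 G1 :: "real \<Rightarrow> real \<Rightarrow> complex" and fl0 fr0 fl1 fr1 :: "real \<Rightarrow> complex" and x0 :: real
  assumes "a < b"
    and "essentially_self_adjoint (einterval a b) (hamiltonian0 a b V0)"
    and "admissible_spectrum a b V0"
    and "susy_transformation a b V0 \<alpha> u"
    and "V1 = partner_potential V0 u"
    and "E \<notin> spec a b V0" and "E \<noteq> complex_of_real \<alpha>"
    and "green_function a b V0 E G0" and "green_function a b V1 E G1"
    and "solves (einterval a b) V0 E fl0" and "\<exists>x\<in>einterval a b. fl0 x \<noteq> 0"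
    and "(fl0 \<longlongrightarrow> 0) (left_end a)"
    and "solves (einterval a b) V0 E fr0" and "\<exists>x\<in>einterval a b. fr0 x \<noteq> 0"
    and "(fr0 \<longlongrightarrow> 0) (right_end b)"
    and "fl1 = susy_op u fl0" and "fr1 = susy_op u fr0"
    and "x0 \<in> einterval a b" and "W0 = wronskian fr0 fl0 x0"
    and "\<exists>l. ((\<lambda>x. fr0 x * fl1 x) \<longlongrightarrow> l) (left_end a)"
    and "\<exists>l. ((\<lambda>x. fr0 x * fl1 x) \<longlongrightarrow> l) (right_end b)"
    and "\<exists>l. ((\<lambda>x. fl0 x * fr1 x) \<longlongrightarrow> l) (left_end a)"
    and "\<exists>l. ((\<lambda>x. fl0 x * fr1 x) \<longlongrightarrow> l) (right_end b)"
  shows "\<exists>Q.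
    has_improper_integral a b (\<lambda>x. G0 x x - G1 x x) (Q / (W0 * (E - of_real \<alpha>))) \<and>
    Q = Lim (right_end b) (\<lambda>x. fr0 x * fl1 x) - Lim (left_end a) (\<lambda>x. fr0 x * fl1 x) \<and>
    Q = Lim (right_end b) (\<lambda>x. fl0 x * fr1 x) - Lim (left_end a) (\<lambda>x. fl0 x * fr1 x) \<and>
    Q = - W0 + Lim (right_end b) (\<lambda>x. fl0 x * fr1 x) - Lim (left_end a) (\<lambda>x. fr0 x * fl1 x) \<and>
    Q = W0 + Lim (right_end b) (\<lambda>x. fr0 x * fl1 x) - Lim (left_end a) (\<lambda>x. fl0 x * fr1 x)"
proof -
  let ?I = "einterval a b"
  note ab = assms(1) and spec = assms(6) and E\<alpha> = assms(7)
  have u: "solves ?I V0 \<alpha> u" "\<And>x. x \<in> ?I \<Longrightarrow> u x \<noteq> 0"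
    and bc: "\<And>f. solves ?I V0 E f \<Longrightarrow> (f \<longlongrightarrow> 0) (left_end a) \<Longrightarrow> (susy_op u f \<longlongrightarrow> 0) (left_end a)"
      "\<And>f. solves ?I V0 E f \<Longrightarrow> (f \<longlongrightarrow> 0) (right_end b) \<Longrightarrow> (susy_op u f \<longlongrightarrow> 0) (right_end b)"
    using assms(4) E\<alpha> unfolding susy_transformation_def by blast+
  define w where "w = superpotential u"
  \<comment> \<open>The quotient rule together with \<open>u'' = (V0 - \<alpha>) u\<close> gives the
    Riccati equation.\<close>
  have dw: "(w has_vector_derivative V0 x - \<alpha> - (w x)\<^sup>2) (at x)" if "x \<in> ?I" for x
  proof -
    note d = solvesD[OF u(1) that, unfolded has_real_derivative_iff_has_vector_derivative[symmetric]]
    have "((\<lambda>x. vd u x / u x) has_real_derivative V0 x - \<alpha> - (vd u x / u x)\<^sup>2) (at x)"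
      using u(2)[OF that]
      by (auto intro!: derivative_eq_intros d simp: field_simps power2_eq_square)
    then show ?thesis
      by (simp add: w_def superpotential_def[abs_def] has_real_derivative_iff_has_vector_derivative)
  qed
  interpret superpotential_pair a b V0 V1 w "vd w" \<alpha>
  proof
    fix x assume x: "x \<in> ?I"
    have eq: "vd w x = V0 x - \<alpha> - (w x)\<^sup>2" by (rule vector_derivative_at[OF dw[OF x]])
    show "(w has_vector_derivative vd w x) (at x)" unfolding eq by (rule dw[OF x])
    show "V0 x = \<alpha> + (w x)\<^sup>2 + vd w x" by (simp add: eq)
    show "V1 x = \<alpha> + (w x)\<^sup>2 - vd w x"
      using eq unfolding assms(5) partner_potential_def w_def[symmetric] by simp
  qed (rule ab)
  have sol: "solution E f (susy_op u f)" if "solves ?I V0 E f" for f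
    unfolding susy_op_def[abs_def] w_def[symmetric]
    using solvesD[OF that] by (intro first_order_systemI) simp_all
  have sl: "solution E fl0 fl1" and sr: "solution E fr0 fr1"
    using sol assms(10,13,16,17) by auto
  have lim1: "(fl1 \<longlongrightarrow> 0) (left_end a)" "(fr1 \<longlongrightarrow> 0) (right_end b)"
    using bc(1)[OF assms(10,12)] bc(2)[OF assms(13,15)] assms(16,17) by auto
  note Ll = square_integrable_left[OF spec sl assms(12) lim1(1)]
    and Lr = square_integrable_right[OF spec sr assms(15) lim1(2)]
  have W: "wronskian fr0 fl0 x = W0" if "x \<in> ?I" for x
    using wronskian_constant[OF sr sl that assms(18)] assms(19) by simp
  \<comment> \<open>Otherwise \<open>fr0\<close> would be a multiple of \<open>fl0\<close>, hence
    vanish and be square integrable at both endpoints, which is impossible off the spectrum.\<close>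
  have "W0 \<noteq> 0"
  proof
    assume "W0 = 0"
    obtain x where x: "x \<in> ?I" "fl0 x \<noteq> 0" using assms(11) by blast
    define c where "c = fr0 x / fl0 x"
    have multiple: "fr0 y = c * fl0 y" if "y \<in> ?I" for y
      unfolding c_def by (rule solution_proportional[OF sr sl x(1) _ x(2) that]) (use W[OF x(1)] \<open>W0 = 0\<close> in simp)
    then have "c \<noteq> 0" using assms(14) by auto
    have lim: "(fr0 \<longlongrightarrow> 0) (left_end a)"
    proof (rule Lim_transform_eventually)
      show "((\<lambda>y. c * fl0 y) \<longlongrightarrow> 0) (left_end a)"
        using tendsto_mult[OF tendsto_const assms(12), of c] by simp
      show "eventually (\<lambda>y. c * fl0 y = fr0 y) (left_end a)"
        unfolding eventually_left_end[OF ab]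
        using x(1) multiple einterval_between[of a _ x b]
        by (intro exI[of _ x]) (auto simp: einterval_iff)
    qed
    have "(\<lambda>y. (norm c)\<^sup>2 * (norm (fl0 y))\<^sup>2) absolutely_integrable_on einterval a x"
      using Ll(1)[OF x(1)] by simp
    then have int: "(\<lambda>y. (norm (fr0 y))\<^sup>2) absolutely_integrable_on einterval a x"
      by (rule set_integrable_cong[THEN iffD1, rotated -1])
        (use x(1) multiple einterval_between[of a _ x b] in \<open>auto simp: einterval_iff norm_mult power_mult_distrib\<close>)
    have "fr0 x \<noteq> 0" using multiple[OF x(1)] \<open>c \<noteq> 0\<close> x(2) by simp
    from no_square_integrable_solution[OF spec assms(13) x(1) this lim assms(15) int Lr(1)[OF x(1)]]
    show False .
  qed
  have W1: "wronskian fr1 fl1 x = (E - \<alpha>) * W0" if "x \<in> ?I" for x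
    using wronskian_partner[OF sr sl that] W[OF that] by simp
  have G0: "G0 x x = fl0 x * fr0 x / W0" if "x \<in> ?I" for x
    by (rule green_function_diagonal[OF ab assms(8,10,12) Ll(1) assms(13,15) Lr(1) W \<open>W0 \<noteq> 0\<close> that])
  have nz: "(E - \<alpha>) * W0 \<noteq> 0" using \<open>W0 \<noteq> 0\<close> E\<alpha> by simp
  \<comment> \<open>The same kernel formula applies to \<open>h1\<close>: the transformation
    preserves the boundary conditions, and the second parts of \<open>Ll\<close> and
    \<open>Lr\<close> give square integrability of \<open>fl1\<close> and
    \<open>fr1\<close>.\<close>
  have G1: "G1 x x = fl1 x * fr1 x / ((E - \<alpha>) * W0)" if "x \<in> ?I" for x
    by (rule green_function_diagonal[OF ab assms(9) solution_partner_solves[OF sl] lim1(1) Ll(2)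
          solution_partner_solves[OF sr] lim1(2) Lr(2) W1 nz that])
  \<comment> \<open>Divided by \<open>W0 * (E - \<alpha>)\<close>, this is an antiderivative of the
    integrand.\<close>
  define \<Phi> where "\<Phi> x = fr0 x * fl1 x" for x
  define Q where "Q = Lim (right_end b) \<Phi> - Lim (left_end a) \<Phi>"
  define den where "den = W0 * (E - \<alpha>)"
  have "den \<noteq> 0" using \<open>W0 \<noteq> 0\<close> E\<alpha> by (simp add: den_def)
  have limL: "(\<Phi> \<longlongrightarrow> Lim (left_end a) \<Phi>) (left_end a)" and limR: "(\<Phi> \<longlongrightarrow> Lim (right_end b) \<Phi>) (right_end b)"
    using assms(20,21) tendsto_Lim[OF left_end_nontrivial[OF ab]] tendsto_Lim[OF right_end_nontrivial[OF ab]]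
    unfolding \<Phi>_def[abs_def] by metis+
  \<comment> \<open>The Wronskian expressed through the first order system. At either endpoint it
    exchanges one product for the other at the cost of \<open>W0\<close>, so all four formulae for
    \<open>Q\<close> follow from the first.\<close>
  have cross: "fl0 x * fr1 x = W0 + \<Phi> x" if "x \<in> ?I" for x
    using W[OF that] unfolding wronskian_eq[OF sr sl that] by (auto simp: \<Phi>_def algebra_simps)
  have evL: "eventually (\<lambda>x. x \<in> ?I) (left_end a)"
    unfolding eventually_left_end[OF ab]
    using assms(18) einterval_between[of a _ x0 b] by (intro exI[of _ x0]) (auto simp: einterval_iff)
  have evR: "eventually (\<lambda>x. x \<in> ?I) (right_end b)"
    unfolding eventually_right_end[OF ab]
    using assms(18) einterval_between[of a x0 _ b] by (intro exI[of _ x0]) (auto simp: einterval_iff)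
  have LimL: "Lim (left_end a) (\<lambda>x. fl0 x * fr1 x) = W0 + Lim (left_end a) \<Phi>"
  proof (rule tendsto_Lim[OF left_end_nontrivial[OF ab]])
    show "((\<lambda>x. fl0 x * fr1 x) \<longlongrightarrow> W0 + Lim (left_end a) \<Phi>) (left_end a)"
      by (rule Lim_transform_eventually[OF tendsto_add[OF tendsto_const limL]])
        (use evL cross in \<open>auto elim: eventually_mono\<close>)
  qed
  have LimR: "Lim (right_end b) (\<lambda>x. fl0 x * fr1 x) = W0 + Lim (right_end b) \<Phi>"
  proof (rule tendsto_Lim[OF right_end_nontrivial[OF ab]])
    show "((\<lambda>x. fl0 x * fr1 x) \<longlongrightarrow> W0 + Lim (right_end b) \<Phi>) (right_end b)"
      by (rule Lim_transform_eventually[OF tendsto_add[OF tendsto_const limR]])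
        (use evR cross in \<open>auto elim: eventually_mono\<close>)
  qed
  have contG: "continuous_on ?I (\<lambda>x. G0 x x - G1 x x)"
  proof (rule continuous_on_eq)
    show "continuous_on ?I (\<lambda>x. fl0 x * fr0 x / W0 - fl1 x * fr1 x / ((E - \<alpha>) * W0))"
      using first_order_system_continuous[OF sl] first_order_system_continuous[OF sr] \<open>W0 \<noteq> 0\<close> E\<alpha>
      by (intro continuous_intros) auto
  qed (simp add: G0 G1)
  have integral_eq: "integral {c..d} (\<lambda>x. G0 x x - G1 x x) = (\<Phi> d - \<Phi> c) / den"
    if cd: "a < ereal c" "c \<le> d" "ereal d < b" for c d
  proof -
    note sub = einterval_Icc_subset[OF cd(1,3)]
    have d\<Phi>: "(\<Phi> has_vector_derivative (E - \<alpha>) * fr0 x * fl0 x - fr1 x * fl1 x) (at x)" if "x \<in> ?I" for x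
      unfolding \<Phi>_def[abs_def] by (rule has_vector_derivative_cross[OF sr sl that])
    have "((\<lambda>x. (E - \<alpha>) * fr0 x * fl0 x - fr1 x * fl1 x) has_integral (\<Phi> d - \<Phi> c)) {c..d}"
      by (rule fundamental_theorem_of_calculus[OF cd(2) has_vector_derivative_at_within[OF d\<Phi>[OF subsetD[OF sub]]]])
    from has_integral_mult_left[OF this, of "inverse den"]
    have "((\<lambda>x. ((E - \<alpha>) * fr0 x * fl0 x - fr1 x * fl1 x) / den) has_integral ((\<Phi> d - \<Phi> c) / den)) {c..d}"
      by (simp add: divide_inverse)
    then have "((\<lambda>x. G0 x x - G1 x x) has_integral ((\<Phi> d - \<Phi> c) / den)) {c..d}"
    proof (rule has_integral_eq[rotated])
      fix x assume "x \<in> {c..d}"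
      then have "x \<in> ?I" using sub by blast
      then show "((E - \<alpha>) * fr0 x * fl0 x - fr1 x * fl1 x) / den = G0 x x - G1 x x"
        using G0 G1 \<open>W0 \<noteq> 0\<close> E\<alpha> by (simp add: den_def field_simps)
    qed
    then show ?thesis by (rule integral_unique)
  qed
  have "has_improper_integral a b (\<lambda>x. G0 x x - G1 x x) (Q / den)"
    unfolding has_improper_integral_def
  proof (intro conjI allI impI)
    fix c d assume cd: "a < ereal c \<and> c \<le> d \<and> ereal d < b"
    show "(\<lambda>x. G0 x x - G1 x x) absolutely_integrable_on {c..d}"
      using cd einterval_Icc_subset[of a c d b]
      by (intro absolutely_integrable_continuous_real continuous_on_subset[OF contG]) auto
  next
    have "((\<lambda>p. (\<Phi> (snd p) - \<Phi> (fst p)) / den) \<longlongrightarrow> (Lim (right_end b) \<Phi> - Lim (left_end a) \<Phi>) / den)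
        (left_end a \<times>\<^sub>F right_end b)"
      using \<open>den \<noteq> 0\<close>
      by (intro tendsto_intros filterlim_compose[OF limR filterlim_snd] filterlim_compose[OF limL filterlim_fst])
    then show "((\<lambda>(c, d). integral {c..d} (\<lambda>x. G0 x x - G1 x x)) \<longlongrightarrow> Q / den) (left_end a \<times>\<^sub>F right_end b)"
      unfolding Q_def
    proof (rule Lim_transform_eventually)
      \<comment> \<open>The limits of integration move independently; the fixed point
        \<open>x0\<close> between them guarantees \<open>c \<le> d\<close>, where the closed form of
        the integral is valid.\<close>
      have "eventually (\<lambda>x. a < ereal x \<and> x \<le> x0) (left_end a)"
        unfolding eventually_left_end[OF ab] using assms(18) by (intro exI[of _ x0]) (auto simp: einterval_iff)
      moreover have "eventually (\<lambda>x. x0 \<le> x \<and> ereal x < b) (right_end b)"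
        unfolding eventually_right_end[OF ab] using assms(18) by (intro exI[of _ x0]) (auto simp: einterval_iff)
      ultimately have "eventually (\<lambda>p. (a < ereal (fst p) \<and> fst p \<le> x0) \<and> (x0 \<le> snd p \<and> ereal (snd p) < b))
          (left_end a \<times>\<^sub>F right_end b)"
        by (rule eventually_prodI)
      then show "eventually (\<lambda>p. (\<Phi> (snd p) - \<Phi> (fst p)) / den =
          (case p of (c, d) \<Rightarrow> integral {c..d} (\<lambda>x. G0 x x - G1 x x))) (left_end a \<times>\<^sub>F right_end b)"
        by (rule eventually_mono) (auto simp: integral_eq split: prod.split)
    qed
  qed
  then show ?thesis
    unfolding den_def LimL LimR \<Phi>_def[symmetric] by (intro exI[of _ Q]) (simp add: Q_def)
qed

end
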